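(* Let $n\ge2$. The quantum transport matrices $T_1,T_2,T_3$ of the triangle satisfy the quantum groupoid relation $$T_1T_2T_3=\mathrm{Id}.$$
   Context: Faces and skew form. Let $I=\{(a,b,c)\in\mathbb Z_{\ge0}^3: a+b+c=n\}$, drawn as a triangular lattice with $(n,0,0)$ at the bottom left, $(0,n,0)$ at the bottom right, $(0,0,n)$ at the top. For each $(a,b,c)\in\mathbb Z_{\ge 0}^3$ with $a+b+c=n-1$ (a white triangle) take the three half-arrows $(a+1,b,c)\to(a,b,c+1)\to(a,b+1,c)\to(a+1,b,c)$; for each $(a,b,c)\in\mathbb Z_{\ge0}^3$ with $a+b+c=n-2$ (a black triangle) take the three half-arrows $(a+1,b,c+1)\to(a+1,b+1,c)\to(a,b+1,c+1)\to(a+1,b,c+1)$. Define the skew-symmetric bilinear form on $\mathbb Q^I$ (basis identified with $I$) by $\langle\alpha,\beta\rangle=\frac12(\#\{\alpha\to\beta\}-\#\{\beta\to\alpha\})$. Quantum torus. The quantum torus has basis $Z_\lambda$, $\lambda\in\mathbb Q^I$, over a field containing all rational powers of the formal variable $q$, with product $Z_\lambda Z_\mu=q^{\langle\lambda,\mu\rangle}Z_{\lambda+\mu}$. For a monomial, its Weyl form $:\prod_\alpha Z_\alpha^{r_\alpha}:$ is $Z_{\sum r_\alpha\alpha}$. Network. The dual directed planar graph has white vertices $w_{abc}$ ($a+b+c=n-1$) and black vertices $b_{abc}$ ($a+b+c=n-2$) located at the centers of the corresponding triangles. Edges: $w_{abc}\to b_{a,b-1,c}$ (if $b\ge1$), $w_{abc}\to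 b_{a,b,c-1}$ (if $c\ge 1$), $b_{abc}\to w_{a+1,b,c}$; source $i$ (right side, $1\le i\le n$) $\to w_{0,i-1,n-i}$; $w_{i-1,0,n-i}\to$ left sink $i'$; $w_{n-i,i-1,0}\to$ bottom sink $i''$. Faces of the graph are labelled by $I$. The weight of a directed path $P$ from a source to a sink is $w(P)=\,:\prod_\alpha Z_\alpha:$, the product over all faces $\alpha$ lying to the right of $P$ (for paths to left sinks these are the faces above the path; for paths to bottom sinks, the faces on the side containing $(n,0,0)$ and $(0,0,n)$). Define $n\times n$ matrices $(\mathcal M_1)_{ij}=\sum_{P:j\leadsto i'}w(P)$, $(\mathcal M_2)_{ij}=\sum_{P:j\leadsto i''}w(P)$. Normalization. $D_1=\,:\prod_{(a,b,c)\in I}Z_{a,b,c}^{c/n}:$, $D_2=\,:\prod_{(a,b,c)\in I}Z_{a,b,c}^{a/n}:$, $Q=\mathrm{diag}(q^{1/2-j})_{j=1}^n$, $S_{ij}=(-1)^{i+1}\delta_{i,n+1-j}$. Set $M_1=QS\mathcal M_1D_1^{-1}$, $M_2=QS\mathcal M_2D_1^{-1}D_2^{-1}$, and let $M_3$ be obtained from $M_1$ by the algebra automorphism $Z_{a,b,c}\mapsto Z_{c,a,b}$ (rotation of the triangle by $4\pi/3$ clockwise) applied to all entries. The quantum transport matrices are $T_1=M_1$, $T_2=M_2^{-1}$, $T_3=M_3$; thus the relation is equivalent to $M_3M_1=M_2$. *)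

theory Defs
  imports
    "HOL-Library.Poly_Mapping"
    "HOL-Computational_Algebra.Fraction_Field"
    "Graph_Theory.Graph_Theory"
    "Jordan_Normal_Form.Matrix"
begin

section \<open>The base field\<close>

text \<open>
  A field containing all rational powers \<open>q\<^sup>r\<close> of a formal variable \<open>q\<close>. That \<open>q\<close> is formal
  means that its powers are linearly independent over the prime field; the integer coefficients
  are compared in the field, so positive characteristic is allowed.
\<close>

class qfield = field +
  fixes qpow :: "rat \<Rightarrow> 'a"
  assumes qpow_add: "qpow (r + s) = qpow r * qpow s"
    and qpow_independent:
      "finite R \<Longrightarrow> (\<Sum>r\<in>R. of_int (c r) * qpow r) = 0 \<Longrightarrow> r \<in> R \<Longrightarrow> of_int (c r) = 0"

lemma qpow_0 [simp]: "qpow 0 = (1 :: 'a::qfield)"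
proof -
  have "qpow 0 \<noteq> (0::'a)"
  proof
    assume "qpow 0 = (0::'a)"
    then have "(of_int 1 :: 'a) = 0"
      using qpow_independent[of "{0}" "\<lambda>_. 1" 0] by simp
    then show False by simp
  qed
  moreover have "qpow 0 * qpow 0 = (qpow 0 :: 'a)"
    using qpow_add[of 0 0, where 'a = 'a] by simp
  ultimately show ?thesis by simp
qed

text \<open>
  The class is inhabited in every characteristic: the fraction field of the group algebra of
  the additive group of rationals.
\<close>

typedef (overloaded) ('a::field) qfun = "UNIV :: (rat \<Rightarrow>\<^sub>0 'a) fract set" ..

setup_lifting type_definition_qfun

instantiation qfun :: (field) field
begin

lift_definition zero_qfun :: "'a qfun" is 0 .
lift_definition one_qfun :: "'a qfun" is 1 .
lift_definition plus_qfun :: "'a qfun \<Rightarrow> 'a qfun \<Rightarrow> 'a qfun" is "(+)" .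
lift_definition minus_qfun :: "'a qfun \<Rightarrow> 'a qfun \<Rightarrow> 'a qfun" is "(-)" .
lift_definition uminus_qfun :: "'a qfun \<Rightarrow> 'a qfun" is uminus .
lift_definition times_qfun :: "'a qfun \<Rightarrow> 'a qfun \<Rightarrow> 'a qfun" is "(*)" .
lift_definition inverse_qfun :: "'a qfun \<Rightarrow> 'a qfun" is inverse .
lift_definition divide_qfun :: "'a qfun \<Rightarrow> 'a qfun \<Rightarrow> 'a qfun" is "(/)" .

instance
  by standard (transfer; simp add: algebra_simps field_class.field_divide_inverse)+

end

instantiation qfun :: (field) qfield
begin

lift_definition qpow_qfun :: "rat \<Rightarrow> 'a qfun" is
  "\<lambda>r. Fraction_Field.Fract (Poly_Mapping.single r 1) 1" .

instance
proof
  have of_nat: "Rep_qfun (of_nat n) = of_nat n" for n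
    by (induction n) (simp_all add: zero_qfun.rep_eq one_qfun.rep_eq plus_qfun.rep_eq)
  have of_int: "Rep_qfun (of_int k) = of_int k" for k
    by (cases k rule: int_cases2) (simp_all add: of_nat uminus_qfun.rep_eq)
  have sum: "Rep_qfun (sum f R) = (\<Sum>r\<in>R. Rep_qfun (f r))" for f :: "rat \<Rightarrow> 'a qfun" and R
    by (induction R rule: infinite_finite_induct)
      (simp_all add: zero_qfun.rep_eq plus_qfun.rep_eq)
  have nat_fract: "of_nat k = Fraction_Field.Fract (of_nat k :: rat \<Rightarrow>\<^sub>0 'a) 1" for k
    by (induction k) (simp_all add: Zero_fract_def One_fract_def)
  have int_fract: "of_int k = Fraction_Field.Fract (of_int k :: rat \<Rightarrow>\<^sub>0 'a) 1" for k
    by (cases k rule: int_cases2) (simp_all add: nat_fract)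
  have sum_fract: "(\<Sum>r\<in>R. Fraction_Field.Fract (f r) 1) = Fraction_Field.Fract (sum f R) 1"
    for f :: "rat \<Rightarrow> (rat \<Rightarrow>\<^sub>0 'a)" and R
    by (induction R rule: infinite_finite_induct) (simp_all add: Zero_fract_def)
  show "of_int (c r) = (0 :: 'a qfun)"
    if fin: "finite R" and eq: "(\<Sum>r\<in>R. of_int (c r) * qpow r) = (0 :: 'a qfun)" and r: "r \<in> R"
    for R c r
  proof -
    have "(\<Sum>r\<in>R. of_int (c r) * Fraction_Field.Fract (Poly_Mapping.single r 1) 1)
        = (0 :: (rat \<Rightarrow>\<^sub>0 'a) fract)"
      using arg_cong[OF eq, of Rep_qfun]
      by (simp add: sum times_qfun.rep_eq of_int qpow_qfun.rep_eq zero_qfun.rep_eq)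
    then have "Fraction_Field.Fract (\<Sum>r\<in>R. Poly_Mapping.single r (of_int (c r) :: 'a)) 1 = 0"
      by (simp add: int_fract single_of_int[symmetric] mult_single sum_fract del: single_of_int)
    then have "(\<Sum>r\<in>R. Poly_Mapping.single r (of_int (c r) :: 'a)) = 0"
      by (simp add: Zero_fract_def eq_fract)
    then have "Poly_Mapping.lookup (\<Sum>r\<in>R. Poly_Mapping.single r (of_int (c r) :: 'a)) r = 0"
      by simp
    then have "(of_int (c r) :: 'a) = 0"
      using fin r by (simp add: lookup_sum lookup_single when_def sum.delta)
    then have "Rep_qfun (of_int (c r) :: 'a qfun) = 0"
      by (simp add: of_int int_fract single_of_int[symmetric] Zero_fract_def del: single_of_int)
    then show ?thesis by (metis Rep_qfun_inject zero_qfun.rep_eq)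
  qed
  show "(qpow (r + s) :: 'a qfun) = qpow r * qpow s" for r s
    by transfer (simp add: mult_single)
qed

end


section \<open>The triangular lattice and the network\<close>

type_synonym face = "nat \<times> nat \<times> nat"

definition lattice :: "nat \<Rightarrow> face set" where
  "lattice n = {(a, b, c). a + b + c = n}"

datatype node =
    White nat nat nat
  | Black nat nat nat
  | Source nat
  | LeftSink nat
  | BottomSink nat

text \<open>
  \<open>White a b c\<close> and \<open>Black a b c\<close> stand both for the triangles and for the vertices of the
  network at their centers. The sum of the coordinates of the corners determines \<open>n\<close>, so the
  half-arrows for all \<open>n\<close> can be put into one family: its restriction to \<open>lattice n\<close> is the
  quiver of size \<open>n\<close>.
\<close>

fun half_arrows :: "node \<Rightarrow> (face \<times> face) set" where
  "half_arrows (White a b c) =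
     {((a+1, b, c), (a, b, c+1)), ((a, b, c+1), (a, b+1, c)), ((a, b+1, c), (a+1, b, c))}"
| "half_arrows (Black a b c) =
     {((a+1, b, c+1), (a+1, b+1, c)), ((a+1, b+1, c), (a, b+1, c+1)),
      ((a, b+1, c+1), (a+1, b, c+1))}"
| "half_arrows _ = {}"

definition num_half_arrows :: "face \<Rightarrow> face \<Rightarrow> nat" where
  "num_half_arrows \<alpha> \<beta> = card {t. (\<alpha>, \<beta>) \<in> half_arrows t}"

definition basis_skew :: "face \<Rightarrow> face \<Rightarrow> rat" where
  "basis_skew \<alpha> \<beta> =
     (of_nat (num_half_arrows \<alpha> \<beta>) - of_nat (num_half_arrows \<beta> \<alpha>)) / 2"

type_synonym exponent = "face \<Rightarrow>\<^sub>0 rat"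

definition skew :: "exponent \<Rightarrow> exponent \<Rightarrow> rat" where
  "skew \<kappa> \<mu> = (\<Sum>\<alpha>\<in>Poly_Mapping.keys \<kappa>. \<Sum>\<beta>\<in>Poly_Mapping.keys \<mu>.
     Poly_Mapping.lookup \<kappa> \<alpha> * Poly_Mapping.lookup \<mu> \<beta> * basis_skew \<alpha> \<beta>)"

definition network_arcs :: "nat \<Rightarrow> (node \<times> node) set" where
  "network_arcs n =
     {(White a b c, Black a (b-1) c) | a b c. a + b + c + 1 = n \<and> b \<ge> 1}
   \<union> {(White a b c, Black a b (c-1)) | a b c. a + b + c + 1 = n \<and> c \<ge> 1}
   \<union> {(Black a b c, White (a+1) b c) | a b c. a + b + c + 2 = n}
   \<union> {(Source i, White 0 (i-1) (n-i)) | i. 1 \<le> i \<and> i \<le> n}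
   \<union> {(White (i-1) 0 (n-i), LeftSink i) | i. 1 \<le> i \<and> i \<le> n}
   \<union> {(White (n-i) (i-1) 0, BottomSink i) | i. 1 \<le> i \<and> i \<le> n}"

definition network :: "nat \<Rightarrow> (node, node \<times> node) pre_digraph" where
  "network n =
     \<lparr> verts = {White a b c | a b c. a + b + c + 1 = n}
             \<union> {Black a b c | a b c. a + b + c + 2 = n}
             \<union> {Source i | i. 1 \<le> i \<and> i \<le> n}
             \<union> {LeftSink i | i. 1 \<le> i \<and> i \<le> n}
             \<union> {BottomSink i | i. 1 \<le> i \<and> i \<le> n},
       arcs = network_arcs n, tail = fst, head = snd \<rparr>"

definition paths :: "nat \<Rightarrow> node \<Rightarrow> node \<Rightarrow> (node \<times> node) list set" where
  "paths n u v = {P. pre_digraph.apath (network n) u P v}"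

text \<open>
  The planar embedding: every arc of the network crosses one edge of the triangular lattice (the
  common side of the two triangles at its ends, or a side of the boundary). Its end points are
  the faces directly to the right and to the left of the arc. An arc from a white vertex goes
  west (to \<open>Black a (b-1) c\<close> or to a left sink) or south (to \<open>Black a b (c-1)\<close> or to a
  bottom sink).
\<close>

fun right_face :: "node \<times> node \<Rightarrow> face" where
  "right_face (White a b c, Black a' b' c') = (if c' = c then (a, b, c+1) else (a+1, b, c))"
| "right_face (White a b c, LeftSink i) = (a, b, c+1)"
| "right_face (White a b c, BottomSink i) = (a+1, b, c)"
| "right_face (Black a b c, v) = (a+1, b, c+1)"
| "right_face (Source i, White a b c) = (a, b, c+1)"
| "right_face _ = undefined"

fun left_face :: "node \<times> node \<Rightarrow> face" where
  "left_face (White a b c, Black a' b' c') = (if c' = c then (a+1, b, c) else (a, b+1, c))"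
| "left_face (White a b c, LeftSink i) = (a+1, b, c)"
| "left_face (White a b c, BottomSink i) = (a, b+1, c)"
| "left_face (Black a b c, v) = (a+1, b+1, c)"
| "left_face (Source i, White a b c) = (a, b+1, c)"
| "left_face _ = undefined"

text \<open>
  The faces to the right of a path are those that can be reached from a face directly to the
  right of one of its arcs by passing from face to face without crossing the path.
\<close>

inductive_set right_faces :: "nat \<Rightarrow> (node \<times> node) list \<Rightarrow> face set"
  for n P where
  along: "e \<in> set P \<Longrightarrow> right_face e \<in> right_faces n P"
| to_left: "right_face e \<in> right_faces n P \<Longrightarrow> e \<in> arcs (network n) \<Longrightarrow> e \<notin> set P
    \<Longrightarrow> left_face e \<in> right_faces n P"
| to_right: "left_face e \<in> right_faces n P \<Longrightarrow> e \<in> arcs (network n) \<Longrightarrow> e \<notin> set P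
    \<Longrightarrow> right_face e \<in> right_faces n P"


section \<open>The quantum torus\<close>

lemma skew_superset:
  assumes "finite A" "finite B" "Poly_Mapping.keys \<kappa> \<subseteq> A" "Poly_Mapping.keys \<mu> \<subseteq> B"
  shows "skew \<kappa> \<mu> = (\<Sum>\<alpha>\<in>A. \<Sum>\<beta>\<in>B.
     Poly_Mapping.lookup \<kappa> \<alpha> * Poly_Mapping.lookup \<mu> \<beta> * basis_skew \<alpha> \<beta>)"
proof -
  have "skew \<kappa> \<mu> = (\<Sum>\<alpha>\<in>Poly_Mapping.keys \<kappa>. \<Sum>\<beta>\<in>B.
     Poly_Mapping.lookup \<kappa> \<alpha> * Poly_Mapping.lookup \<mu> \<beta> * basis_skew \<alpha> \<beta>)"
    unfolding skew_def using assms
    by (intro sum.cong refl sum.mono_neutral_left) (auto simp: in_keys_iff)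
  also have "\<dots> = (\<Sum>\<alpha>\<in>A. \<Sum>\<beta>\<in>B.
     Poly_Mapping.lookup \<kappa> \<alpha> * Poly_Mapping.lookup \<mu> \<beta> * basis_skew \<alpha> \<beta>)"
    using assms by (intro sum.mono_neutral_left) (auto simp: in_keys_iff)
  finally show ?thesis .
qed

lemma skew_add_left: "skew (\<kappa> + \<kappa>') \<mu> = skew \<kappa> \<mu> + skew \<kappa>' \<mu>"
proof -
  define A where "A = Poly_Mapping.keys \<kappa> \<union> Poly_Mapping.keys \<kappa>'"
  have A: "finite A" "Poly_Mapping.keys \<kappa> \<subseteq> A" "Poly_Mapping.keys \<kappa>' \<subseteq> A"
    "Poly_Mapping.keys (\<kappa> + \<kappa>') \<subseteq> A"
    using keys_add[of \<kappa> \<kappa>'] by (auto simp: A_def)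
  show ?thesis
    by (simp add: skew_superset[OF A(1) finite_keys A(2) order.refl]
        skew_superset[OF A(1) finite_keys A(3) order.refl]
        skew_superset[OF A(1) finite_keys A(4) order.refl] lookup_add ring_distribs sum.distrib)
qed

lemma skew_swap: "skew \<mu> \<kappa> = - skew \<kappa> \<mu>"
proof -
  have swap: "u * v * basis_skew \<beta> \<alpha> = - (v * u * basis_skew \<alpha> \<beta>)" for u v \<alpha> \<beta>
    by (simp add: basis_skew_def field_simps)
  show ?thesis
    unfolding skew_def sum_negf[symmetric] by (subst sum.swap) (intro sum.cong refl swap)
qed

lemma skew_add_right: "skew \<mu> (\<kappa> + \<kappa>') = skew \<mu> \<kappa> + skew \<mu> \<kappa>'"
  using skew_add_left[of \<kappa> \<kappa>' \<mu>] by (simp add: skew_swap[of _ \<mu>])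

lemma skew_zero [simp]: "skew 0 \<mu> = 0" "skew \<mu> 0 = 0"
  by (simp_all add: skew_def)

lemma skew_self [simp]: "skew \<kappa> \<kappa> = 0"
  using skew_swap[of \<kappa> \<kappa>] by simp

text \<open>
  The elements of the quantum torus are the finite linear combinations of the \<open>Z\<^sub>\<kappa>\<close>. Like the
  skew form, the type comprises all \<open>n\<close> at once, with one variable for each triple of naturals;
  the quantum torus of the triangle of size \<open>n\<close> is its subring \<open>quantum_torus n\<close> below.
\<close>

typedef (overloaded) ('k::zero) qtorus = "UNIV :: (exponent \<Rightarrow>\<^sub>0 'k) set"
  morphisms coeffs Abs_qtorus ..

setup_lifting type_definition_qtorus

definition twisted_mult ::
    "(exponent \<Rightarrow>\<^sub>0 'k::qfield) \<Rightarrow> (exponent \<Rightarrow>\<^sub>0 'k) \<Rightarrow> exponent \<Rightarrow>\<^sub>0 'k" where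
  "twisted_mult x y = (\<Sum>\<kappa>\<in>Poly_Mapping.keys x. \<Sum>\<mu>\<in>Poly_Mapping.keys y.
     Poly_Mapping.single (\<kappa> + \<mu>) (qpow (skew \<kappa> \<mu>) * Poly_Mapping.lookup x \<kappa> * Poly_Mapping.lookup y \<mu>))"

lemma twisted_mult_add_left: "twisted_mult (x + x') y = twisted_mult x y + twisted_mult x' y"
  unfolding twisted_mult_def
  by (rule setsum_keys_plus_distrib)
    (simp_all add: single_add ring_distribs sum.distrib)

lemma twisted_mult_add_right: "twisted_mult x (y + y') = twisted_mult x y + twisted_mult x y'"
  unfolding twisted_mult_def sum.distrib[symmetric]
  by (intro sum.cong refl setsum_keys_plus_distrib)
    (simp_all add: single_add ring_distribs)

lemma twisted_mult_zero [simp]: "twisted_mult 0 y = 0" "twisted_mult y 0 = 0"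
  by (simp_all add: twisted_mult_def)

lemma twisted_mult_single:
  "twisted_mult (Poly_Mapping.single \<kappa> u) (Poly_Mapping.single \<mu> v)
    = Poly_Mapping.single (\<kappa> + \<mu>) (qpow (skew \<kappa> \<mu>) * u * v)"
  by (simp add: twisted_mult_def)

lemma poly_mapping_single_add_induct:
  assumes "P 0" and "\<And>\<kappa> u. P (Poly_Mapping.single \<kappa> u)" and "\<And>x y. P x \<Longrightarrow> P y \<Longrightarrow> P (x + y)"
  shows "P (x :: 'a \<Rightarrow>\<^sub>0 'b::comm_monoid_add)"
proof -
  have "P (\<Sum>\<kappa>\<in>A. Poly_Mapping.single \<kappa> (Poly_Mapping.lookup x \<kappa>))" if "finite A" for A
    using that by induction (simp_all add: assms)
  moreover have "x = (\<Sum>\<kappa>\<in>Poly_Mapping.keys x. Poly_Mapping.single \<kappa> (Poly_Mapping.lookup x \<kappa>))"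
    by (rule poly_mapping_eqI)
      (auto simp: lookup_sum lookup_single when_def sum.delta in_keys_iff)
  ultimately show ?thesis by (metis finite_keys)
qed

lemma twisted_mult_assoc:
  "twisted_mult (twisted_mult x y) z = twisted_mult x (twisted_mult y z)"
proof (induction x rule: poly_mapping_single_add_induct)
  case (2 \<kappa> u)
  show ?case
  proof (induction y rule: poly_mapping_single_add_induct)
    case (2 \<mu> v)
    show ?case
      by (induction z rule: poly_mapping_single_add_induct)
        (simp_all add: twisted_mult_single twisted_mult_add_right skew_add_left skew_add_right
          qpow_add ac_simps)
  qed (simp_all add: twisted_mult_add_left twisted_mult_add_right)
qed (simp_all add: twisted_mult_add_left)

lemma twisted_mult_one:
  "twisted_mult (Poly_Mapping.single 0 1) x = x" "twisted_mult x (Poly_Mapping.single 0 1) = x"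
  by (induction x rule: poly_mapping_single_add_induct;
      simp add: twisted_mult_single twisted_mult_add_left twisted_mult_add_right
        del: single_one)+

instantiation qtorus :: (qfield) ring_1
begin

lift_definition zero_qtorus :: "'a qtorus" is 0 .
lift_definition one_qtorus :: "'a qtorus" is "Poly_Mapping.single 0 1" .
lift_definition plus_qtorus :: "'a qtorus \<Rightarrow> 'a qtorus \<Rightarrow> 'a qtorus" is "(+)" .
lift_definition minus_qtorus :: "'a qtorus \<Rightarrow> 'a qtorus \<Rightarrow> 'a qtorus" is "(-)" .
lift_definition uminus_qtorus :: "'a qtorus \<Rightarrow> 'a qtorus" is uminus .
lift_definition times_qtorus :: "'a qtorus \<Rightarrow> 'a qtorus \<Rightarrow> 'a qtorus" is twisted_mult .

instance
proof
  show "(0 :: 'a qtorus) \<noteq> 1"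
    by transfer (metis lookup_single_eq lookup_zero zero_neq_one)
qed (transfer; simp add: algebra_simps twisted_mult_assoc twisted_mult_one
    twisted_mult_add_left twisted_mult_add_right del: single_one)+

end

text \<open>\<open>monom u \<kappa>\<close> is \<open>u Z\<^sub>\<kappa>\<close>.\<close>

definition monom :: "'k \<Rightarrow> exponent \<Rightarrow> 'k::qfield qtorus" where
  "monom u \<kappa> = Abs_qtorus (Poly_Mapping.single \<kappa> u)"

lemma monom_mult: "monom u \<kappa> * monom v \<mu> = monom (qpow (skew \<kappa> \<mu>) * u * v) (\<kappa> + \<mu>)"
  by (simp add: monom_def times_qtorus.abs_eq eq_onp_def twisted_mult_single)

abbreviation Z :: "exponent \<Rightarrow> 'k::qfield qtorus" where
  "Z \<equiv> monom 1"

abbreviation scalar :: "'k \<Rightarrow> 'k::qfield qtorus" where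
  "scalar u \<equiv> monom u 0"

lemma Z_mult: "Z \<kappa> * Z \<mu> = scalar (qpow (skew \<kappa> \<mu>)) * (Z (\<kappa> + \<mu>) :: 'k::qfield qtorus)"
  by (simp add: monom_mult)

lemma Z_zero: "Z 0 = (1 :: 'k::qfield qtorus)"
  by (simp add: monom_def one_qtorus_def)

lemma skew_uminus_right: "skew \<kappa> (- \<mu>) = - skew \<kappa> \<mu>"
proof -
  have "skew \<kappa> (\<mu> + (- \<mu>)) = 0" by simp
  then show ?thesis unfolding skew_add_right by simp
qed

lemma Z_inverse: "Z \<kappa> * Z (- \<kappa>) = (1 :: 'k::qfield qtorus)" "Z (- \<kappa>) * Z \<kappa> = (1 :: 'k qtorus)"
  by (simp_all add: monom_mult Z_zero skew_uminus_right skew_swap[of "- \<kappa>" \<kappa>])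

definition quantum_torus :: "nat \<Rightarrow> 'k::qfield qtorus set" where
  "quantum_torus n = {x. \<forall>\<kappa>\<in>Poly_Mapping.keys (coeffs x). Poly_Mapping.keys \<kappa> \<subseteq> lattice n}"

text \<open>
  The automorphism sending the variable of the face \<open>(a, b, c)\<close> to that of \<open>(c, a, b)\<close>, as the
  linear map \<open>Z\<^sub>\<kappa> \<mapsto> Z\<^sub>\<mu>\<close> with \<open>\<mu> = rotate_exponent \<kappa>\<close>.
\<close>

fun rotate_face :: "face \<Rightarrow> face" where
  "rotate_face (a, b, c) = (c, a, b)"

definition rotate_exponent :: "exponent \<Rightarrow> exponent" where
  "rotate_exponent \<kappa> = (\<Sum>\<alpha>\<in>Poly_Mapping.keys \<kappa>. Poly_Mapping.single (rotate_face \<alpha>)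
     (Poly_Mapping.lookup \<kappa> \<alpha>))"

definition rotate :: "'k::qfield qtorus \<Rightarrow> 'k qtorus" where
  "rotate x = (\<Sum>\<kappa>\<in>Poly_Mapping.keys (coeffs x).
     monom (Poly_Mapping.lookup (coeffs x) \<kappa>) (rotate_exponent \<kappa>))"


section \<open>The transport matrices\<close>

text \<open>Matrices have entries indexed from 0; \<open>mat1\<close> takes a function of indices starting at 1.\<close>

definition mat1 :: "nat \<Rightarrow> (nat \<Rightarrow> nat \<Rightarrow> 'a) \<Rightarrow> 'a mat" where
  "mat1 n f = mat n n (\<lambda>(i, j). f (Suc i) (Suc j))"

text \<open>The Weyl-ordered product of \<open>Z\<^sub>\<alpha>\<close> over the faces to the right of the path.\<close>

definition weight :: "nat \<Rightarrow> (node \<times> node) list \<Rightarrow> 'k::qfield qtorus" where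
  "weight n P = Z (\<Sum>\<alpha>\<in>right_faces n P. Poly_Mapping.single \<alpha> 1)"

definition calM1 :: "nat \<Rightarrow> 'k::qfield qtorus mat" where
  "calM1 n = mat1 n (\<lambda>i j. \<Sum>P\<in>paths n (Source j) (LeftSink i). weight n P)"

definition calM2 :: "nat \<Rightarrow> 'k::qfield qtorus mat" where
  "calM2 n = mat1 n (\<lambda>i j. \<Sum>P\<in>paths n (Source j) (BottomSink i). weight n P)"

definition D1_exponent :: "nat \<Rightarrow> exponent" where
  "D1_exponent n = (\<Sum>(a, b, c)\<in>lattice n. Poly_Mapping.single (a, b, c) (of_nat c / of_nat n))"

definition D2_exponent :: "nat \<Rightarrow> exponent" where
  "D2_exponent n = (\<Sum>(a, b, c)\<in>lattice n. Poly_Mapping.single (a, b, c) (of_nat a / of_nat n))"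

text \<open>
  \<open>D\<^sub>1 = Z (D1_exponent n)\<close>, with inverse \<open>Z (- D1_exponent n)\<close> by \<open>Z_inverse\<close>; likewise \<open>D\<^sub>2\<close>.
\<close>

definition D1_inv :: "nat \<Rightarrow> 'k::qfield qtorus" where
  "D1_inv n = Z (- D1_exponent n)"

definition D2_inv :: "nat \<Rightarrow> 'k::qfield qtorus" where
  "D2_inv n = Z (- D2_exponent n)"

definition Qmat :: "nat \<Rightarrow> 'k::qfield qtorus mat" where
  "Qmat n = mat1 n (\<lambda>i j. if i = j then scalar (qpow (1/2 - of_nat j)) else 0)"

definition Smat :: "nat \<Rightarrow> 'k::qfield qtorus mat" where
  "Smat n = mat1 n (\<lambda>i j. if i = n + 1 - j then (-1) ^ (i + 1) else 0)"

definition M1 :: "nat \<Rightarrow> 'k::qfield qtorus mat" where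
  "M1 n = map_mat (\<lambda>x. x * D1_inv n) (Qmat n * Smat n * calM1 n)"

definition M2 :: "nat \<Rightarrow> 'k::qfield qtorus mat" where
  "M2 n = map_mat (\<lambda>x. x * D1_inv n * D2_inv n) (Qmat n * Smat n * calM2 n)"

definition M3 :: "nat \<Rightarrow> 'k::qfield qtorus mat" where
  "M3 n = map_mat rotate (M1 n)"

text \<open>
  Two-sided inverse of a square matrix over the quantum torus of size \<open>n\<close>; unique if it exists.
\<close>

definition is_inverse_mat :: "nat \<Rightarrow> 'k::qfield qtorus mat \<Rightarrow> 'k qtorus mat \<Rightarrow> bool" where
  "is_inverse_mat n A B \<longleftrightarrow> B \<in> carrier_mat n n \<and> elements_mat B \<subseteq> quantum_torus n \<and>
     inverts_mat A B \<and> inverts_mat B A"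

definition T1 :: "nat \<Rightarrow> 'k::qfield qtorus mat" where
  "T1 n = M1 n"

definition T2 :: "nat \<Rightarrow> 'k::qfield qtorus mat" where
  "T2 n = (THE B. is_inverse_mat n (M2 n) B)"

definition T3 :: "nat \<Rightarrow> 'k::qfield qtorus mat" where
  "T3 n = M3 n"

end

theory Submission
  imports Defs
begin

text \<open>
  The theorem is the identity \<open>M3 n * M1 n = M2 n\<close> together with the invertibility of \<open>M1 n\<close> and
  \<open>M2 n\<close>.

  A path from a source to a sink is determined by its sequence of steps west and south between
  white vertices. On the line where the first coordinate is \<open>a\<close>, the faces to its right are
  those above the white vertex that it visits there (\<open>right_faces_step_path\<close>). The entries of
  \<open>M3 n\<close> come from the same paths after a rotation: these run from the left side to the bottom,
  and their weights collect the faces below them. So an entry of \<open>M3 n * M1 n\<close> is a sum over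
  pairs: a path \<open>P\<close> from the right side to the left side, and a rotated path \<open>Q\<close> that starts
  where \<open>P\<close> ends and goes back to the bottom. A rotated south step goes east, that is, it
  retraces a west step.

  Most pairs cancel (\<open>sum_pairs_cancel\<close>). Let \<open>Q\<close> retrace the last \<open>t\<close> steps of \<open>P\<close> and no more,
  and let \<open>Q\<close> not end there. Either \<open>Q\<close> goes on with a rotated west step, or it goes on with a
  rotated south step after a south step of \<open>P\<close>; exchanging these two ways of passing through the
  same black triangle is a bijection. It moves a strip of \<open>t + 1\<close> faces from one region to the
  other, so the product of the weights changes only by a power of \<open>q\<close>. The pairing of the strip
  with the sum of both regions is \<open>- 1\<close> (\<open>skew_strip\<close>), and that power is compensated by the
  matrix \<open>Qmat\<close>, since the meeting point of the two paths moves by one position; the matrix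
  \<open>Smat\<close> makes the signs opposite.

  In the remaining pairs \<open>Q\<close> consists of steps that retrace \<open>P\<close>. Its region then fills up the
  region of \<open>P\<close> to the one of a path from the source to a bottom sink, which gives the entry of
  \<open>M2 n\<close> (\<open>pair_term_backtrack\<close>). The factors \<open>D\<^sub>1\<close> and \<open>D\<^sub>2\<close> commute with all variables up to
  powers of \<open>q\<close> that come from the corners of the triangle only, so they contribute the same
  constant to all terms.

  Up to the order of the rows, \<open>M1 n\<close> and \<open>M2 n\<close> are triangular with monomials on the diagonal.
  Such matrices are inverted by substitution, over any ring (\<open>triangular_right_inverse\<close>).
\<close>


section \<open>Paths as sequences of steps\<close>

datatype step = West | South

fun step_arcs :: "nat \<Rightarrow> nat \<Rightarrow> nat \<Rightarrow> step list \<Rightarrow> (node \<times> node) list" where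
  "step_arcs a b c [] = []"
| "step_arcs a b c (West # ws) = (White a b c, Black a (b-1) c)
     # (Black a (b-1) c, White (a+1) (b-1) c) # step_arcs (a+1) (b-1) c ws"
| "step_arcs a b c (South # ws) = (White a b c, Black a b (c-1))
     # (Black a b (c-1), White (a+1) b (c-1)) # step_arcs (a+1) b (c-1) ws"

lemma count_West_South: "count_list ws West + count_list ws South = length ws"
proof (induction ws)
  case (Cons s ws)
  then show ?case by (cases s) auto
qed simp

abbreviation end_white :: "nat \<Rightarrow> nat \<Rightarrow> nat \<Rightarrow> step list \<Rightarrow> node" where
  "end_white a b c ws \<equiv> White (a + length ws) (b - count_list ws West) (c - count_list ws South)"

text \<open>
  Only white vertices branch: from a black vertex there is a single arc. So a walk is read off
  two arcs at a time, and it can only end by leaving through a side of the triangle.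
\<close>

lemma walk_from_white:
  assumes "pre_digraph.cas (network n) (White a b c) es v" "set es \<subseteq> network_arcs n"
    "a + b + c + 1 = n" "v \<in> range LeftSink \<union> range BottomSink"
  shows "\<exists>ws. count_list ws West \<le> b \<and> count_list ws South \<le> c
    \<and> es = step_arcs a b c ws @ [(end_white a b c ws, v)]"
  using assms
proof (induction es arbitrary: a b c rule: length_induct)
  case (1 es)
  have sinks: "es = []" if "pre_digraph.cas (network n) u es v" "set es \<subseteq> network_arcs n"
      "u \<in> range LeftSink \<union> range BottomSink" for u es
    using that by (cases es) (auto simp: pre_digraph.cas.simps network_def network_arcs_def)
  obtain e es1 where es: "es = e # es1" and e: "fst e = White a b c" "e \<in> network_arcs n"
    and es1: "pre_digraph.cas (network n) (snd e) es1 v" "set es1 \<subseteq> network_arcs n"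
    using "1.prems" by (cases es) (auto simp: pre_digraph.cas.simps network_def)
  from e consider
      (west) "e = (White a b c, Black a (b-1) c)" "b \<ge> 1"
    | (south) "e = (White a b c, Black a b (c-1))" "c \<ge> 1"
    | (exit) "snd e \<in> range LeftSink \<union> range BottomSink"
    by (cases e) (auto simp: network_arcs_def)
  then show ?case
  proof cases
    case west
    then obtain e2 es2 where es2: "es1 = e2 # es2" "e2 \<in> network_arcs n" "fst e2 = Black a (b-1) c"
      "pre_digraph.cas (network n) (snd e2) es2 v" "set es2 \<subseteq> network_arcs n"
      using es1 "1.prems"(4) by (cases es1) (auto simp: pre_digraph.cas.simps network_def)
    have e2: "e2 = (Black a (b-1) c, White (a+1) (b-1) c)"
      using es2(2,3) by (cases e2) (auto simp: network_arcs_def)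
    have "\<exists>ws. count_list ws West \<le> b - 1 \<and> count_list ws South \<le> c
        \<and> es2 = step_arcs (a+1) (b-1) c ws @ [(end_white (a+1) (b-1) c ws, v)]"
      using "1.IH"[rule_format, of es2 "a+1" "b-1" c] es2 e2 es west "1.prems"(3,4) by auto
    then obtain ws where "count_list ws West \<le> b - 1 \<and> count_list ws South \<le> c
        \<and> es2 = step_arcs (a+1) (b-1) c ws @ [(end_white (a+1) (b-1) c ws, v)]" ..
    then show ?thesis
      using west e2 es es2(1) by (intro exI[of _ "West # ws"]) auto
  next
    case south
    then obtain e2 es2 where es2: "es1 = e2 # es2" "e2 \<in> network_arcs n" "fst e2 = Black a b (c-1)"
      "pre_digraph.cas (network n) (snd e2) es2 v" "set es2 \<subseteq> network_arcs n"
      using es1 "1.prems"(4) by (cases es1) (auto simp: pre_digraph.cas.simps network_def)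
    have e2: "e2 = (Black a b (c-1), White (a+1) b (c-1))"
      using es2(2,3) by (cases e2) (auto simp: network_arcs_def)
    have "\<exists>ws. count_list ws West \<le> b \<and> count_list ws South \<le> c - 1
        \<and> es2 = step_arcs (a+1) b (c-1) ws @ [(end_white (a+1) b (c-1) ws, v)]"
      using "1.IH"[rule_format, of es2 "a+1" b "c-1"] es2 e2 es south "1.prems"(3,4) by auto
    then obtain ws where "count_list ws West \<le> b \<and> count_list ws South \<le> c - 1
        \<and> es2 = step_arcs (a+1) b (c-1) ws @ [(end_white (a+1) b (c-1) ws, v)]" ..
    then show ?thesis
      using south e2 es es2(1) by (intro exI[of _ "South # ws"]) auto
  next
    case exit
    then have "es1 = []" "snd e = v"
      using sinks[OF es1] es1(1) by (auto simp: pre_digraph.cas.simps)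
    then show ?thesis
      using es e(1) by (intro exI[of _ "[]"]) (cases e, auto)
  qed
qed

lemma walk_of_steps:
  assumes "count_list ws West \<le> b" "count_list ws South \<le> c" "a + b + c + 1 = n"
    "(end_white a b c ws, v) \<in> network_arcs n"
  shows "pre_digraph.cas (network n) (White a b c) (step_arcs a b c ws @ [(end_white a b c ws, v)]) v"
    and "set (step_arcs a b c ws @ [(end_white a b c ws, v)]) \<subseteq> network_arcs n"
proof -
  have "pre_digraph.cas (network n) (White a b c) (step_arcs a b c ws @ [(end_white a b c ws, v)]) v
    \<and> set (step_arcs a b c ws) \<subseteq> network_arcs n"
    using assms(1-3)
  proof (induction a b c ws rule: step_arcs.induct)
    case (2 a b c ws)
    then show ?case
      by (auto simp: pre_digraph.cas.simps network_def network_arcs_def)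
  next
    case (3 a b c ws)
    then show ?case
      by (auto simp: pre_digraph.cas.simps network_def network_arcs_def)
  qed (auto simp: pre_digraph.cas.simps network_def)
  then show "pre_digraph.cas (network n) (White a b c) (step_arcs a b c ws @ [(end_white a b c ws, v)]) v"
    and "set (step_arcs a b c ws @ [(end_white a b c ws, v)]) \<subseteq> network_arcs n"
    using assms(4) by auto
qed

text \<open>Every arc increases the depth, so that no walk visits a vertex twice.\<close>

fun depth :: "nat \<Rightarrow> node \<Rightarrow> nat" where
  "depth n (Source i) = 0"
| "depth n (White a b c) = 2 * a + 1"
| "depth n (Black a b c) = 2 * a + 2"
| "depth n _ = 2 * n + 1"

lemma distinct_walk:
  assumes "pre_digraph.cas (network n) u es v" "set es \<subseteq> network_arcs n"
  shows "distinct (pre_digraph.awalk_verts (network n) u es)"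
proof -
  have "distinct (pre_digraph.awalk_verts (network n) u es)
    \<and> (\<forall>x \<in> set (pre_digraph.awalk_verts (network n) u es). depth n u \<le> depth n x)"
    using assms
  proof (induction es arbitrary: u)
    case (Cons e es)
    obtain x y where e: "e = (x, y)" by (cases e)
    have "depth n x < depth n y"
      using Cons.prems(2) e by (auto simp: network_arcs_def)
    moreover have "u = x" "pre_digraph.cas (network n) y es v"
      using Cons.prems(1) e by (auto simp: pre_digraph.cas.simps network_def)
    ultimately show ?case
      using Cons.IH[of y] Cons.prems(2) e
      by (auto simp: pre_digraph.awalk_verts.simps network_def)
  qed (simp add: pre_digraph.awalk_verts.simps)
  then show ?thesis ..
qed

definition step_path :: "nat \<Rightarrow> nat \<Rightarrow> step list \<Rightarrow> node \<Rightarrow> (node \<times> node) list" where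
  "step_path n j ws v = (Source j, White 0 (j-1) (n-j)) # step_arcs 0 (j-1) (n-j) ws
     @ [(end_white 0 (j-1) (n-j) ws, v)]"

lemma paths_to_sink:
  assumes "1 \<le> j" "j \<le> n" "v \<in> range LeftSink \<union> range BottomSink"
  shows "paths n (Source j) v = (\<lambda>ws. step_path n j ws v) `
    {ws. count_list ws West \<le> j - 1 \<and> count_list ws South \<le> n - j
      \<and> (end_white 0 (j-1) (n-j) ws, v) \<in> network_arcs n}" (is "_ = ?rhs")
proof (intro equalityI subsetI)
  fix es assume "es \<in> paths n (Source j) v"
  then have cas: "pre_digraph.cas (network n) (Source j) es v" and arcs: "set es \<subseteq> network_arcs n"
    by (auto simp: paths_def pre_digraph.apath_def pre_digraph.awalk_def network_def)
  then obtain e es1 where es: "es = e # es1" and e: "fst e = Source j" "e \<in> network_arcs n"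
    and es1: "pre_digraph.cas (network n) (snd e) es1 v" "set es1 \<subseteq> network_arcs n"
    using assms(3) by (cases es) (auto simp: pre_digraph.cas.simps network_def)
  have e': "e = (Source j, White 0 (j-1) (n-j))"
    using e by (cases e) (auto simp: network_arcs_def)
  then obtain ws where "count_list ws West \<le> j-1" "count_list ws South \<le> n-j"
    "es1 = step_arcs 0 (j-1) (n-j) ws @ [(end_white 0 (j-1) (n-j) ws, v)]"
    using walk_from_white[of n 0 "j-1" "n-j" es1 v] es1 assms by auto
  then show "es \<in> ?rhs"
    using es e' arcs by (intro image_eqI[of _ _ ws]) (auto simp: step_path_def)
next
  fix es assume "es \<in> ?rhs"
  then obtain ws where ws: "es = step_path n j ws v" "count_list ws West \<le> j-1"
    "count_list ws South \<le> n-j" "(end_white 0 (j-1) (n-j) ws, v) \<in> network_arcs n"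
    by auto
  have "pre_digraph.cas (network n) (Source j) es v" "set es \<subseteq> network_arcs n"
    using walk_of_steps[of ws "j-1" "n-j" 0 n v] ws assms
    by (auto simp: step_path_def pre_digraph.cas.simps network_def network_arcs_def)
  then show "es \<in> paths n (Source j) v"
    using distinct_walk[of n "Source j" es v] assms
    by (auto simp: paths_def pre_digraph.apath_def pre_digraph.awalk_def network_def)
qed

lemma step_arcs_inject:
  "step_arcs a b c ws = step_arcs a b c ws' \<longleftrightarrow> ws = ws'" if "length ws = length ws'"
    "count_list ws West \<le> b" "count_list ws' West \<le> b"
    "count_list ws South \<le> c" "count_list ws' South \<le> c"
  using that
proof (induction ws ws' arbitrary: a b c rule: list_induct2)
  case (Cons s ws s' ws')
  then show ?case by (cases s; cases s') auto
qed simp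

lemma length_step_arcs: "length (step_arcs a b c ws) = 2 * length ws"
  by (induction a b c ws rule: step_arcs.induct) auto

lemma inj_on_step_path:
  "inj_on (\<lambda>ws. step_path n j ws v)
    {ws. count_list ws West \<le> j - 1 \<and> count_list ws South \<le> n - j \<and> Q ws}"
proof (rule inj_onI)
  fix ws ws'
  assume ws: "ws \<in> {ws. count_list ws West \<le> j - 1 \<and> count_list ws South \<le> n - j \<and> Q ws}"
    "ws' \<in> {ws. count_list ws West \<le> j - 1 \<and> count_list ws South \<le> n - j \<and> Q ws}"
    and eq: "step_path n j ws v = step_path n j ws' v"
  from eq have arcs: "step_arcs 0 (j-1) (n-j) ws = step_arcs 0 (j-1) (n-j) ws'"
    by (simp add: step_path_def)
  then have "length ws = length ws'"
    using length_step_arcs by (metis mult_left_cancel zero_neq_numeral)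
  with arcs ws show "ws = ws'" using step_arcs_inject by auto
qed

section \<open>The faces to the right of a path\<close>

text \<open>
  After \<open>a\<close> steps a path from \<open>Source j\<close> is at height \<open>n - j - count_list (take a ws) South\<close>;
  the faces on line \<open>a\<close> to its right have a larger third coordinate. With \<open>h = n - j\<close>, the
  inequality is written without subtraction. The lines that the path does not reach lie to its
  left if it ends on the left side, and to its right if it ends at the bottom; this is the flag
  \<open>beyond\<close>.
\<close>

definition region :: "nat \<Rightarrow> nat \<Rightarrow> step list \<Rightarrow> bool \<Rightarrow> face set" where
  "region n h ws beyond = {(a, b, c). a + b + c = n \<and>
     (if a \<le> length ws then h < c + count_list (take a ws) South else beyond)}"

lemma mem_region [simp]:
  "(a, b, c) \<in> region n h ws beyond \<longleftrightarrow> a + b + c = n \<and>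
     (if a \<le> length ws then h < c + count_list (take a ws) South else beyond)"
  by (simp add: region_def)

lemma count_take_Suc:
  "m < length ws \<Longrightarrow>
    count_list (take (Suc m) ws) s = count_list (take m ws) s + (if ws ! m = s then 1 else 0)"
  by (simp add: take_Suc_conv_app_nth)

lemma count_take_West_South:
  "m \<le> length ws \<Longrightarrow> count_list (take m ws) West + count_list (take m ws) South = m"
  by (simp add: count_West_South)

lemma count_take_le: "count_list (take m ws) s \<le> count_list ws s"
  by (metis append_take_drop_id count_list_append le_add1)

lemma set_step_arcs:
  "set (step_arcs a b c ws) = (\<Union>m<length ws.
     {(White (a+m) (b - count_list (take m ws) West) (c - count_list (take m ws) South),
       Black (a+m) (b - count_list (take (Suc m) ws) West) (c - count_list (take (Suc m) ws) South)),
      (Black (a+m) (b - count_list (take (Suc m) ws) West) (c - count_list (take (Suc m) ws) South),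
       White (a+m+1) (b - count_list (take (Suc m) ws) West) (c - count_list (take (Suc m) ws) South))})"
  by (induction a b c ws rule: step_arcs.induct)
    (simp_all add: lessThan_Suc_eq_insert_0 insert_commute)

context
  fixes n j :: nat and ws :: "step list" and v :: node
  assumes j: "1 \<le> j" "j \<le> n"
    and v: "v \<in> range LeftSink \<union> range BottomSink"
    and west: "count_list ws West \<le> j - 1" and south: "count_list ws South \<le> n - j"
    and exit: "(end_white 0 (j-1) (n-j) ws, v) \<in> network_arcs n"
begin

private abbreviation s where "s m \<equiv> count_list (take m ws) South"
private abbreviation w where "w m \<equiv> count_list (take m ws) West"
private abbreviation P where "P \<equiv> step_path n j ws v"

private lemma bounds: "w m \<le> j - 1" "s m \<le> n - j"
  using count_take_le[of m ws] west south order_trans by blast+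

text \<open>
  A white vertex is on the path as soon as its height is right, because the three coordinates
  have a fixed sum.
\<close>

private lemma minus_iff:
  assumes "m \<le> length ws" "m + y + z + 1 = n"
  shows "y = j - 1 - w m \<and> z = n - j - s m \<longleftrightarrow> z + s m = n - j"
proof -
  obtain h where n: "n = h + j" using j(2) le_Suc_ex add.commute by metis
  obtain k where k: "j = Suc k" using j(1) by (cases j) auto
  have "y = j - 1 - w m \<longleftrightarrow> y + w m = k" "z = n - j - s m \<longleftrightarrow> z + s m = h"
    using bounds[of m] n k by auto
  then show ?thesis using count_take_West_South[OF assms(1)] assms(2) n k by auto
qed

private lemma step: "m < length ws \<Longrightarrow>
   (ws ! m = West \<and> w (Suc m) = Suc (w m) \<and> s (Suc m) = s m) \<or>
   (ws ! m = South \<and> w (Suc m) = w m \<and> s (Suc m) = Suc (s m))"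
  by (cases "ws ! m") (auto simp: count_take_Suc)

private lemma set_P: "set P = {(Source j, White 0 (j-1) (n-j)), (end_white 0 (j-1) (n-j) ws, v)} \<union>
   (\<Union>m<length ws.
     {(White m (j - 1 - w m) (n - j - s m), Black m (j - 1 - w (Suc m)) (n - j - s (Suc m))),
      (Black m (j - 1 - w (Suc m)) (n - j - s (Suc m)),
       White (Suc m) (j - 1 - w (Suc m)) (n - j - s (Suc m)))})"
  by (auto simp: step_path_def set_step_arcs)

text \<open>
  Exactly one arc enters a given white vertex, and it separates two neighbours on the same line.
  This holds on the right side too, where the arc comes from a source.
\<close>

private lemma enter_arc:
  assumes e: "e \<in> network_arcs n" "snd e = White x y z"
  shows "(e \<in> set P \<longleftrightarrow> x \<le> length ws \<and> z + s x = n - j) \<and> x + y + z + 1 = n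
    \<and> right_face e = (x, y, z+1) \<and> left_face e = (x, y+1, z)"
proof -
  have v': "v \<noteq> White x y z" using v by auto
  from e consider (source) i where "e = (Source i, White 0 (i-1) (n-i))" "1 \<le> i" "i \<le> n"
      "x = 0" "y = i - 1" "z = n - i"
    | (black) a where "e = (Black a y z, White (a+1) y z)" "a + y + z + 2 = n" "x = a + 1"
    by (auto simp: network_arcs_def)
  then show ?thesis
  proof cases
    case source
    then show ?thesis using v' j by (auto simp: set_P)
  next
    case black
    have "e \<in> set P \<longleftrightarrow> a < length ws \<and> y = j - 1 - w (Suc a) \<and> z = n - j - s (Suc a)"
      using black v' by (auto simp: set_P)
    also have "\<dots> \<longleftrightarrow> x \<le> length ws \<and> z + s x = n - j"
      using minus_iff[of "Suc a" y z] black by (cases "a < length ws") auto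
    finally show ?thesis using black by auto
  qed
qed

private lemma inner_arc:
  assumes "x + y + z + 1 = n" "x + y' + z' + 2 = n"
  shows "(White x y z, Black x y' z') \<in> set P \<longleftrightarrow> x < length ws \<and> z + s x = n - j \<and> z' + s (Suc x) = n - j"
proof -
  have "(White x y z, Black x y' z') \<in> set P \<longleftrightarrow> x < length ws \<and> y = j - 1 - w x \<and> z = n - j - s x
    \<and> y' = j - 1 - w (Suc x) \<and> z' = n - j - s (Suc x)"
    using v by (auto simp: set_P)
  then show ?thesis
    using minus_iff[of x y z] minus_iff[of "Suc x" y' z'] assms
    by (cases "x < length ws") auto
qed

private lemma exit_cases:
  obtains (left) "v = LeftSink (Suc (length ws))" "count_list ws West = j - 1"
      "Suc (length ws) \<le> n"
  | (bottom) "v = BottomSink (j - count_list ws West)" "count_list ws South = n - j"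
      "Suc (length ws) \<le> n"
proof -
  have "count_list ws West + count_list ws South = length ws" by (rule count_West_South)
  then show ?thesis
    using exit v west south j left bottom by (auto simp: network_arcs_def)
qed

text \<open>
  The path separates its region from the other faces: the two faces at an arc are on different
  sides only if the arc belongs to the path. For arcs between different lines this uses that the
  height drops by at most one in each step, and for arcs through a side that the path leaves the
  triangle once only.
\<close>

lemma region_crossing:
  assumes e: "e \<in> network_arcs n"
  shows "if e \<in> set P then right_face e \<in> region n (n-j) ws (v \<in> range BottomSink)
    else right_face e \<in> region n (n-j) ws (v \<in> range BottomSink) \<longleftrightarrow>
      left_face e \<in> region n (n-j) ws (v \<in> range BottomSink)"
proof -
  from e consider (enter) x y z where "snd e = White x y z"
    | (west) x y z where "e = (White x y z, Black x (y-1) z)" "x + y + z + 1 = n" "y \<ge> 1"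
    | (south) x y z where "e = (White x y z, Black x y (z-1))" "x + y + z + 1 = n" "z \<ge> 1"
    | (left) i where "e = (White (i-1) 0 (n-i), LeftSink i)" "1 \<le> i" "i \<le> n"
    | (bottom) i where "e = (White (n-i) (i-1) 0, BottomSink i)" "1 \<le> i" "i \<le> n"
    by (auto simp: network_arcs_def)
  then show ?thesis
  proof cases
    case enter
    show ?thesis using enter_arc[OF e enter] by auto
  next
    case west
    then have "e \<in> set P \<longleftrightarrow> x < length ws \<and> z + s x = n - j \<and> z + s (Suc x) = n - j"
      using inner_arc[of x y z "y-1" z] by auto
    moreover have "right_face e = (x, y, z+1)" "left_face e = (x+1, y, z)" using west by auto
    moreover have "x = length ws \<Longrightarrow> (v \<in> range BottomSink) \<longleftrightarrow> n - j < z + 1 + s x"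
      by (cases rule: exit_cases) (use west count_West_South[of ws] j in auto)
    ultimately show ?thesis using step[of x] west by (cases x "length ws" rule: linorder_cases) auto
  next
    case south
    then have "e \<in> set P \<longleftrightarrow> x < length ws \<and> z + s x = n - j \<and> z - 1 + s (Suc x) = n - j"
      using inner_arc[of x y z y "z-1"] by auto
    moreover have "right_face e = (x+1, y, z)" "left_face e = (x, y+1, z)" using south by auto
    moreover have "x = length ws \<Longrightarrow> (v \<in> range BottomSink) \<longleftrightarrow> n - j < z + s x"
      by (cases rule: exit_cases) (use south count_West_South[of ws] j in auto)
    ultimately show ?thesis using step[of x] south by (cases x "length ws" rule: linorder_cases) auto
  next
    case left
    define x where "x = i - 1"
    have e: "e = (White x 0 (n-i), LeftSink i)" "i = Suc x" "x < n"
      using left by (auto simp: x_def)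
    have faces: "right_face e = (x, 0, n-i+1)" "left_face e = (x+1, 0, n-i)" using e by auto
    have P: "e \<in> set P \<longleftrightarrow> e = (end_white 0 (j-1) (n-j) ws, v)" using e by (simp add: set_P)
    show ?thesis
    proof (cases x "length ws" rule: linorder_cases)
      case less
      then have notin: "e \<notin> set P" unfolding P using e by simp
      have "n - j < n - i + 1 + s x \<longleftrightarrow> n - j < n - i + s (x + 1)"
        using step[OF less] bounds[of "Suc x"] count_take_West_South[of x ws] j less e(2,3) by auto
      then show ?thesis using less notin left(3) e(2) by (simp add: faces)
    next
      case equal
      show ?thesis
      proof (cases rule: exit_cases)
        case left
        then have "e \<in> set P"
          unfolding P using e equal count_West_South[of ws] j by auto
        moreover have "n - j < n - i + 1 + s x"
          using left equal e(2) count_West_South[of ws] j by auto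
        ultimately show ?thesis using e(2,3) equal by (simp add: faces)
      next
        case bottom
        then have "e \<notin> set P" unfolding P using e equal by simp
        moreover have "n - j < n - i + 1 + s x" "v \<in> range BottomSink"
          using bottom equal by auto
        ultimately show ?thesis using e(2,3) equal by (simp add: faces)
      qed
    next
      case greater
      then have "e \<notin> set P" unfolding P using e by simp
      then show ?thesis using greater e(2,3) by (simp add: faces)
    qed
  next
    case bottom
    define x where "x = n - i"
    have e: "e = (White x (i-1) 0, BottomSink i)" "x + i = n" "1 \<le> i"
      using bottom by (auto simp: x_def)
    have faces: "right_face e = (x+1, i-1, 0)" "left_face e = (x, i, 0)" using e by auto
    have P: "e \<in> set P \<longleftrightarrow> e = (end_white 0 (j-1) (n-j) ws, v)" using e by (simp add: set_P)
    show ?thesis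
    proof (cases x "length ws" rule: linorder_cases)
      case less
      then have "e \<notin> set P" unfolding P using e by simp
      then show ?thesis using less bounds[of "Suc x"] bounds[of x] by (simp add: faces not_less)
    next
      case equal
      show ?thesis
      proof (cases rule: exit_cases)
        case left
        then have "e \<notin> set P" "v \<notin> range BottomSink" unfolding P using e equal by auto
        then show ?thesis using bounds[of x] equal by (simp add: faces not_less)
      next
        case bottom
        then have "e \<in> set P"
          unfolding P using e equal count_West_South[of ws] j west by auto
        then show ?thesis using bottom e equal by (simp add: faces)
      qed
    next
      case greater
      then have "e \<notin> set P" unfolding P using e by simp
      then show ?thesis using greater e(2,3) by (simp add: faces)
    qed
  qed
qed

lemma P_arcs: "set P \<subseteq> network_arcs n"
  using walk_of_steps(2)[of ws "j-1" "n-j" 0 n v] west south exit j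
  by (auto simp: step_path_def network_arcs_def)

text \<open>
  One inclusion is \<open>region_crossing\<close>. For the other, each line that the path visits is climbed
  from the face above the path, and the lines beyond a bottom sink are entered from the face
  next to that sink and then reached one after the other.
\<close>

lemma right_faces_step_path: "right_faces n P = region n (n-j) ws (v \<in> range BottomSink)"
proof (intro equalityI subsetI)
  fix \<alpha> assume "\<alpha> \<in> right_faces n P"
  then show "\<alpha> \<in> region n (n-j) ws (v \<in> range BottomSink)"
  proof induction
    case (along e)
    then show ?case using region_crossing[of e] P_arcs by auto
  next
    case (to_left e)
    then show ?case using region_crossing[of e] by (auto simp: network_def)
  next
    case (to_right e)
    then show ?case using region_crossing[of e] by (auto simp: network_def)
  qed
next
  have enter_ex: "\<exists>e \<in> network_arcs n. snd e = White x y z" if "x + y + z + 1 = n" for x y z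
  proof (cases x)
    case 0
    then have "(Source (y+1), White x y z) \<in> network_arcs n" using that by (auto simp: network_arcs_def)
    then show ?thesis by force
  next
    case (Suc a)
    then have "(Black a y z, White x y z) \<in> network_arcs n" using that by (auto simp: network_arcs_def)
    then show ?thesis by force
  qed
  \<comment> \<open>The path meets each line in one white vertex, so above that vertex nothing blocks the way.\<close>
  have climb: "(x, y - d, z + d) \<in> right_faces n P"
    if start: "(x, y, z) \<in> right_faces n P" and line: "x + y + z = n" and "d \<le> y"
      and above: "\<And>z'. x \<le> length ws \<Longrightarrow> z \<le> z' \<Longrightarrow> z' + s x \<noteq> n - j" for x y z d
    using \<open>d \<le> y\<close>
  proof (induction d)
    case 0
    then show ?case using start by simp
  next
    case (Suc d)
    obtain e where e: "e \<in> network_arcs n" "snd e = White x (y - Suc d) (z + d)"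
      using enter_ex[of x "y - Suc d" "z + d"] line Suc.prems by auto
    have "e \<notin> set P" "right_face e = (x, y - Suc d, z + Suc d)" "left_face e = (x, y - d, z + d)"
      using enter_arc[OF e] above[of "z+d"] Suc.prems by auto
    then show ?case
      using right_faces.to_right[of e n P] Suc e by (auto simp: network_def)
  qed
  have near: "(x, y, z) \<in> right_faces n P"
    if "x \<le> length ws" "x + y + z = n" "n - j < z + s x" for x y z
  proof -
    have x: "w x + s x = x" using that by (intro count_take_West_South)
    have "x + (j - 1 - w x) + (n - j - s x) + 1 = n"
      using x bounds[of x] j by auto
    then obtain e where e: "e \<in> network_arcs n" "snd e = White x (j - 1 - w x) (n - j - s x)"
      using enter_ex by blast
    have "e \<in> set P" "right_face e = (x, j - 1 - w x, n - j - s x + 1)"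
      using enter_arc[OF e] that(1) bounds[of x] by auto
    then have start: "(x, j - 1 - w x, n - j - s x + 1) \<in> right_faces n P"
      by (metis right_faces.along)
    have "(x, (j - 1 - w x) - (z - (n - j - s x + 1)), (n - j - s x + 1) + (z - (n - j - s x + 1)))
       \<in> right_faces n P"
      by (rule climb[OF start]) (use x that bounds[of x] j in auto)
    moreover have "(j - 1 - w x) - (z - (n - j - s x + 1)) = y" "(n - j - s x + 1) + (z - (n - j - s x + 1)) = z"
      using x that bounds[of x] j by auto
    ultimately show ?thesis by simp
  qed
  have far: "(length ws + Suc d, y, z) \<in> right_faces n P"
    if bottom: "v \<in> range BottomSink" and "length ws + Suc d + y + z = n" for d y z
    using \<open>length ws + Suc d + y + z = n\<close>
  proof (induction d arbitrary: y z)
    case 0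
    have v: "v = BottomSink (j - count_list ws West)" "count_list ws South = n - j"
      by (rule exit_cases; use bottom in auto)+
    have "(end_white 0 (j-1) (n-j) ws, v) \<in> set P" by (simp add: set_P)
    from right_faces.along[OF this, of n]
    have "(length ws + 1, j - 1 - count_list ws West, 0) \<in> right_faces n P"
      using v by simp
    then have "(length ws + 1, (j - 1 - count_list ws West) - z, 0 + z) \<in> right_faces n P"
      by (rule climb) (use v 0 count_West_South[of ws] j west in auto)
    moreover have "(j - 1 - count_list ws West) - z = y"
      using v 0 count_West_South[of ws] j west by auto
    ultimately show ?case by simp
  next
    case (Suc d)
    \<comment> \<open>Cross from the line before, through an arc going west or to a left sink.\<close>
    let ?x = "length ws + Suc d"
    show ?case
    proof (cases "y = 0")
      case True
      define e where "e = (White ?x y z, LeftSink (Suc ?x))"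
      have "e = (White (Suc ?x - 1) 0 (n - Suc ?x), LeftSink (Suc ?x))" "Suc ?x \<le> n" "1 \<le> Suc ?x"
        using True Suc.prems by (simp_all add: e_def)
      then have "e \<in> network_arcs n" unfolding network_arcs_def by blast
      moreover have "e \<notin> set P" using bottom by (auto simp: e_def set_P)
      ultimately show ?thesis
        using right_faces.to_left[of e n P] Suc.IH[of y "z+1"] Suc.prems by (auto simp: e_def network_def)
    next
      case False
      define e where "e = (White ?x y z, Black ?x (y-1) z)"
      have "e \<in> network_arcs n" using False Suc.prems by (auto simp: e_def network_arcs_def)
      moreover have "e \<notin> set P" using v by (auto simp: e_def set_P)
      ultimately show ?thesis
        using right_faces.to_left[of e n P] Suc.IH[of y "z+1"] Suc.prems by (auto simp: e_def network_def)
    qed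
  qed
  fix \<alpha> assume \<alpha>: "\<alpha> \<in> region n (n-j) ws (v \<in> range BottomSink)"
  obtain x y z where xyz: "\<alpha> = (x, y, z)" by (cases \<alpha>)
  show "\<alpha> \<in> right_faces n P"
  proof (cases "x \<le> length ws")
    case True
    then show ?thesis using \<alpha> xyz near by auto
  next
    case False
    then obtain d where "x = length ws + Suc d" by (metis add_Suc_right less_imp_Suc_add not_le)
    then show ?thesis using \<alpha> xyz far[of d y z] by auto
  qed
qed

end

section \<open>The skew form near a face\<close>

text \<open>
  The half-arrow along an edge of the lattice occurs once for each triangle at that edge, hence
  twice inside the triangle and once on its boundary.
\<close>

lemma num_half_arrows_into:
  "num_half_arrows \<beta> (x, y, z) =
     (if z > 0 \<and> \<beta> = (x + 1, y, z - 1) then if y > 0 then 2 else 1 else 0) +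
     (if y > 0 \<and> \<beta> = (x, y - 1, z + 1) then if x > 0 then 2 else 1 else 0) +
     (if x > 0 \<and> \<beta> = (x - 1, y + 1, z) then if z > 0 then 2 else 1 else 0)"
proof -
  define S1 where "S1 = insert (White x y (z - 1)) (if y > 0 then {Black x (y - 1) (z - 1)} else {})"
  define S2 where "S2 = insert (White x (y - 1) z) (if x > 0 then {Black (x - 1) (y - 1) z} else {})"
  define S3 where "S3 = insert (White (x - 1) y z) (if z > 0 then {Black (x - 1) y (z - 1)} else {})"
  have card: "card S1 = (if y > 0 then 2 else 1)" "card S2 = (if x > 0 then 2 else 1)"
    "card S3 = (if z > 0 then 2 else 1)"
    by (simp_all add: S1_def S2_def S3_def)
  have 1: "{t. (\<beta>, (x, y, z)) \<in> half_arrows t} = S1" if "\<beta> = (x + 1, y, z - 1)" "z > 0"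
  proof (rule subset_antisym; rule subsetI)
    fix t assume "t \<in> {t. (\<beta>, (x, y, z)) \<in> half_arrows t}"
    then show "t \<in> S1" using that by (cases t) (auto simp: S1_def)
  next
    fix t assume "t \<in> S1"
    then show "t \<in> {t. (\<beta>, (x, y, z)) \<in> half_arrows t}" using that by (auto simp: S1_def split: if_splits)
  qed
  have 2: "{t. (\<beta>, (x, y, z)) \<in> half_arrows t} = S2" if "\<beta> = (x, y - 1, z + 1)" "y > 0"
  proof (rule subset_antisym; rule subsetI)
    fix t assume "t \<in> {t. (\<beta>, (x, y, z)) \<in> half_arrows t}"
    then show "t \<in> S2" using that by (cases t) (auto simp: S2_def)
  next
    fix t assume "t \<in> S2"
    then show "t \<in> {t. (\<beta>, (x, y, z)) \<in> half_arrows t}" using that by (auto simp: S2_def split: if_splits)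
  qed
  have 3: "{t. (\<beta>, (x, y, z)) \<in> half_arrows t} = S3" if "\<beta> = (x - 1, y + 1, z)" "x > 0"
  proof (rule subset_antisym; rule subsetI)
    fix t assume "t \<in> {t. (\<beta>, (x, y, z)) \<in> half_arrows t}"
    then show "t \<in> S3" using that by (cases t) (auto simp: S3_def)
  next
    fix t assume "t \<in> S3"
    then show "t \<in> {t. (\<beta>, (x, y, z)) \<in> half_arrows t}" using that by (auto simp: S3_def split: if_splits)
  qed
  consider (one) "\<beta> = (x + 1, y, z - 1)" "z > 0" | (two) "\<beta> = (x, y - 1, z + 1)" "y > 0"
    | (three) "\<beta> = (x - 1, y + 1, z)" "x > 0"
    | (none) "\<not> (z > 0 \<and> \<beta> = (x + 1, y, z - 1))" "\<not> (y > 0 \<and> \<beta> = (x, y - 1, z + 1))"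
        "\<not> (x > 0 \<and> \<beta> = (x - 1, y + 1, z))"
    by blast
  then show ?thesis
  proof cases
    case one
    then show ?thesis unfolding num_half_arrows_def 1[OF one] card by simp
  next
    case two
    then show ?thesis unfolding num_half_arrows_def 2[OF two] card by simp
  next
    case three
    then show ?thesis unfolding num_half_arrows_def 3[OF three] card by simp
  next
    case none
    have "(\<beta>, (x, y, z)) \<notin> half_arrows t" for t
      using none by (cases t) auto
    then show ?thesis unfolding num_half_arrows_def using none by (simp only: if_False) simp
  qed
qed

lemma num_half_arrows_from:
  "num_half_arrows (x, y, z) \<beta> =
     (if x > 0 \<and> \<beta> = (x - 1, y, z + 1) then if y > 0 then 2 else 1 else 0) +
     (if z > 0 \<and> \<beta> = (x, y + 1, z - 1) then if x > 0 then 2 else 1 else 0) +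
     (if y > 0 \<and> \<beta> = (x + 1, y - 1, z) then if z > 0 then 2 else 1 else 0)"
  by (cases \<beta>) (auto simp: num_half_arrows_into)

text \<open>
  Around an inner face three incoming and three outgoing neighbours alternate. The summands with
  value zero or weight \<open>1 / 2\<close> account for the corners and the sides.
\<close>

lemma skew_single:
  "skew \<mu> (Poly_Mapping.single (x, y, z) 1) =
     (if z > 0 then Poly_Mapping.lookup \<mu> (x + 1, y, z - 1) * (if y > 0 then 1 else 1 / 2) else 0) +
     (if y > 0 then Poly_Mapping.lookup \<mu> (x, y - 1, z + 1) * (if x > 0 then 1 else 1 / 2) else 0) +
     (if x > 0 then Poly_Mapping.lookup \<mu> (x - 1, y + 1, z) * (if z > 0 then 1 else 1 / 2) else 0) -
     (if x > 0 then Poly_Mapping.lookup \<mu> (x - 1, y, z + 1) * (if y > 0 then 1 else 1 / 2) else 0) -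
     (if z > 0 then Poly_Mapping.lookup \<mu> (x, y + 1, z - 1) * (if x > 0 then 1 else 1 / 2) else 0) -
     (if y > 0 then Poly_Mapping.lookup \<mu> (x + 1, y - 1, z) * (if z > 0 then 1 else 1 / 2) else 0)"
proof -
  define N where "N = {(x + 1, y, z - 1), (x, y - 1, z + 1), (x - 1, y + 1, z),
    (x - 1, y, z + 1), (x, y + 1, z - 1), (x + 1, y - 1, z)}"
  define A where "A = Poly_Mapping.keys \<mu> \<union> N"
  have A: "finite A" "Poly_Mapping.keys \<mu> \<subseteq> A" "N \<subseteq> A" by (auto simp: A_def N_def)
  have pick: "(\<Sum>\<beta>\<in>A. Poly_Mapping.lookup \<mu> \<beta> * (if Q \<and> \<beta> = \<alpha> then if R then 2 else 1 else 0) / 2)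
      = (if Q then Poly_Mapping.lookup \<mu> \<alpha> * (if R then 1 else 1 / 2) else 0)"
    if "\<alpha> \<in> A" for Q R \<alpha>
  proof -
    have "(\<Sum>\<beta>\<in>A. Poly_Mapping.lookup \<mu> \<beta> * (if Q \<and> \<beta> = \<alpha> then if R then 2 else 1 else 0) / 2)
      = (\<Sum>\<beta>\<in>A. if \<beta> = \<alpha> then (if Q then Poly_Mapping.lookup \<mu> \<alpha> * (if R then 1 else 1 / 2) else 0) else 0)"
      by (intro sum.cong) auto
    then show ?thesis using that A(1) by simp
  qed
  have "skew \<mu> (Poly_Mapping.single (x, y, z) 1) =
      (\<Sum>\<beta>\<in>A. Poly_Mapping.lookup \<mu> \<beta> * basis_skew \<beta> (x, y, z))"
    by (subst skew_superset[OF A(1) _ A(2), of "{(x, y, z)}"]) auto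
  also have "\<dots> = (\<Sum>\<beta>\<in>A.
      Poly_Mapping.lookup \<mu> \<beta> * (if z > 0 \<and> \<beta> = (x + 1, y, z - 1) then if y > 0 then 2 else 1 else 0) / 2 +
      Poly_Mapping.lookup \<mu> \<beta> * (if y > 0 \<and> \<beta> = (x, y - 1, z + 1) then if x > 0 then 2 else 1 else 0) / 2 +
      Poly_Mapping.lookup \<mu> \<beta> * (if x > 0 \<and> \<beta> = (x - 1, y + 1, z) then if z > 0 then 2 else 1 else 0) / 2 -
      Poly_Mapping.lookup \<mu> \<beta> * (if x > 0 \<and> \<beta> = (x - 1, y, z + 1) then if y > 0 then 2 else 1 else 0) / 2 -
      Poly_Mapping.lookup \<mu> \<beta> * (if z > 0 \<and> \<beta> = (x, y + 1, z - 1) then if x > 0 then 2 else 1 else 0) / 2 -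
      Poly_Mapping.lookup \<mu> \<beta> * (if y > 0 \<and> \<beta> = (x + 1, y - 1, z) then if z > 0 then 2 else 1 else 0) / 2)"
  proof (rule sum.cong[OF refl])
    have distrib: "m * ((of_nat (p1 + p2 + p3) - of_nat (q1 + q2 + q3)) / 2) =
        m * of_nat p1 / 2 + m * of_nat p2 / 2 + m * of_nat p3 / 2
        - m * of_nat q1 / 2 - m * of_nat q2 / 2 - m * of_nat q3 / (2 :: rat)" for m p1 p2 p3 q1 q2 q3
      by (simp add: field_simps)
    have of_nat_if: "of_nat (if Q then if R then 2 else 1 else 0) = (if Q then if R then 2 else 1 else (0 :: rat))"
      for Q R by simp
    fix \<beta>
    show "Poly_Mapping.lookup \<mu> \<beta> * basis_skew \<beta> (x, y, z) =
      Poly_Mapping.lookup \<mu> \<beta> * (if z > 0 \<and> \<beta> = (x + 1, y, z - 1) then if y > 0 then 2 else 1 else 0) / 2 +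
      Poly_Mapping.lookup \<mu> \<beta> * (if y > 0 \<and> \<beta> = (x, y - 1, z + 1) then if x > 0 then 2 else 1 else 0) / 2 +
      Poly_Mapping.lookup \<mu> \<beta> * (if x > 0 \<and> \<beta> = (x - 1, y + 1, z) then if z > 0 then 2 else 1 else 0) / 2 -
      Poly_Mapping.lookup \<mu> \<beta> * (if x > 0 \<and> \<beta> = (x - 1, y, z + 1) then if y > 0 then 2 else 1 else 0) / 2 -
      Poly_Mapping.lookup \<mu> \<beta> * (if z > 0 \<and> \<beta> = (x, y + 1, z - 1) then if x > 0 then 2 else 1 else 0) / 2 -
      Poly_Mapping.lookup \<mu> \<beta> * (if y > 0 \<and> \<beta> = (x + 1, y - 1, z) then if z > 0 then 2 else 1 else 0) / 2"
      unfolding basis_skew_def num_half_arrows_into num_half_arrows_from distrib of_nat_if ..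
  qed
  finally show ?thesis
    using A(3) by (simp only: sum.distrib sum_subtractf pick[OF subsetD[OF A(3)]] N_def insert_iff simp_thms)
qed

lemma mem_lattice [simp]: "(a, b, c) \<in> lattice n \<longleftrightarrow> a + b + c = n"
  by (simp add: lattice_def)

lemma finite_lattice [simp]: "finite (lattice n)"
proof (rule finite_subset)
  show "lattice n \<subseteq> {..n} \<times> {..n} \<times> {..n}" by (auto simp: lattice_def)
qed auto

lemma lookup_lattice_sum:
  "Poly_Mapping.lookup (\<Sum>(a, b, c)\<in>lattice n. Poly_Mapping.single (a, b, c) (f a b c)) (x, y, z) =
     (if x + y + z = n then f x y z else 0)"
proof -
  have "Poly_Mapping.lookup (\<Sum>(a, b, c)\<in>lattice n. Poly_Mapping.single (a, b, c) (f a b c)) (x, y, z) =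
    (\<Sum>\<alpha>\<in>lattice n. if \<alpha> = (x, y, z) then f x y z else 0)"
    by (auto simp: lookup_sum lookup_single case_prod_unfold when_def intro!: sum.cong)
  then show ?thesis by simp
qed

text \<open>
  The exponents \<open>D1_exponent\<close> and \<open>D2_exponent\<close> are linear functions on the lattice, and a
  linear function has the same sum over the incoming as over the outgoing neighbours of an inner
  face. The same holds on the sides, with the weights there; only two corners remain.
\<close>

lemma skew_D1_single:
  assumes "x + y + z = n" "n > 0"
  shows "skew (D1_exponent n) (Poly_Mapping.single (x, y, z) 1) =
    ((if y = n then 1 else 0) - (if x = n then 1 else 0)) / (2 * of_nat n)"
  using assms unfolding D1_exponent_def skew_single
  by (cases x; cases y; cases z) (simp_all add: lookup_lattice_sum field_simps of_nat_diff)

lemma skew_D2_single: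
  assumes "x + y + z = n" "n > 0"
  shows "skew (D2_exponent n) (Poly_Mapping.single (x, y, z) 1) =
    ((if z = n then 1 else 0) - (if y = n then 1 else 0)) / (2 * of_nat n)"
  using assms unfolding D2_exponent_def skew_single
  by (cases x; cases y; cases z) (simp_all add: lookup_lattice_sum field_simps of_nat_diff)

definition face_sum :: "face set \<Rightarrow> exponent" where
  "face_sum A = (\<Sum>\<alpha>\<in>A. Poly_Mapping.single \<alpha> 1)"

lemma skew_sum_right: "skew \<mu> (sum f A) = (\<Sum>\<alpha>\<in>A. skew \<mu> (f \<alpha>))"
  by (induction A rule: infinite_finite_induct) (simp_all add: skew_add_right)

lemma lookup_face_sum: "finite A \<Longrightarrow> Poly_Mapping.lookup (face_sum A) \<beta> = (if \<beta> \<in> A then 1 else 0)"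
  by (simp add: face_sum_def lookup_sum lookup_single when_def)

lemma skew_D1_face_sum:
  assumes "A \<subseteq> lattice n" "n > 0"
  shows "skew (D1_exponent n) (face_sum A) =
    ((if (0, n, 0) \<in> A then 1 else 0) - (if (n, 0, 0) \<in> A then 1 else 0)) / (2 * of_nat n)"
proof -
  have fin: "finite A" using assms(1) finite_lattice finite_subset by blast
  have "skew (D1_exponent n) (Poly_Mapping.single \<alpha> 1) =
      (if \<alpha> = (0, n, 0) then 1 / (2 * of_nat n) else 0) - (if \<alpha> = (n, 0, 0) then 1 / (2 * of_nat n) else 0)"
    if "\<alpha> \<in> A" for \<alpha>
  proof -
    obtain x y z where \<alpha>: "\<alpha> = (x, y, z)" by (cases \<alpha>)
    then have "x + y + z = n" using that assms(1) by (auto simp: lattice_def)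
    with \<alpha> skew_D1_single[OF this assms(2)] show ?thesis by auto
  qed
  then show ?thesis
    unfolding face_sum_def skew_sum_right using fin by (simp add: sum_subtractf diff_divide_distrib)
qed

lemma skew_D2_face_sum:
  assumes "A \<subseteq> lattice n" "n > 0"
  shows "skew (D2_exponent n) (face_sum A) =
    ((if (0, 0, n) \<in> A then 1 else 0) - (if (0, n, 0) \<in> A then 1 else 0)) / (2 * of_nat n)"
proof -
  have fin: "finite A" using assms(1) finite_lattice finite_subset by blast
  have "skew (D2_exponent n) (Poly_Mapping.single \<alpha> 1) =
      (if \<alpha> = (0, 0, n) then 1 / (2 * of_nat n) else 0) - (if \<alpha> = (0, n, 0) then 1 / (2 * of_nat n) else 0)"
    if "\<alpha> \<in> A" for \<alpha>
  proof -
    obtain x y z where \<alpha>: "\<alpha> = (x, y, z)" by (cases \<alpha>)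
    then have "x + y + z = n" using that assms(1) by (auto simp: lattice_def)
    with \<alpha> skew_D2_single[OF this assms(2)] show ?thesis by auto
  qed
  then show ?thesis
    unfolding face_sum_def skew_sum_right using fin by (simp add: sum_subtractf diff_divide_distrib)
qed

lemma skew_scale_right: "skew \<mu> (Poly_Mapping.single \<alpha> r) = r * skew \<mu> (Poly_Mapping.single \<alpha> 1)"
  by (cases "r = 0") (simp_all add: skew_def sum_distrib_left mult_ac)

lemma skew_D1_D2:
  assumes "n > 0"
  shows "skew (D1_exponent n) (D2_exponent n) = - 1 / (2 * of_nat n)"
proof -
  have "skew (D1_exponent n) (case \<alpha> of (a, b, c) \<Rightarrow> Poly_Mapping.single (a, b, c) (of_nat a / of_nat n)) =
      (if \<alpha> = (n, 0, 0) then - 1 / (2 * of_nat n) else 0)"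
    if "\<alpha> \<in> lattice n" for \<alpha>
  proof -
    obtain x y z where \<alpha>: "\<alpha> = (x, y, z)" by (cases \<alpha>)
    then have "x + y + z = n" using that by (auto simp: lattice_def)
    with \<alpha> skew_D1_single[OF this assms] assms show ?thesis
      by (auto simp: skew_scale_right[of _ _ "_ / _"])
  qed
  then have "skew (D1_exponent n) (D2_exponent n) =
      (\<Sum>\<alpha>\<in>lattice n. if \<alpha> = (n, 0, 0) then - 1 / (2 * of_nat n) else 0)"
    unfolding D2_exponent_def skew_sum_right by (intro sum.cong refl)
  then show ?thesis by simp
qed

section \<open>Exchanging steps in a pair of paths\<close>

text \<open>
  The region of a path, rotated. In the rotated picture the path runs from the left side
  eastwards, the columns of constant \<open>b\<close> take the place of the lines, and
  \<open>count_list (drop b ws) West\<close> is the height that is left after \<open>b\<close> steps. The region lies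
  below the path.
\<close>

definition rotated_region :: "nat \<Rightarrow> step list \<Rightarrow> face set" where
  "rotated_region n ws = {(a, b, c). a + b + c = n \<and> b \<le> length ws \<and> c \<le> count_list (drop b ws) West}"

lemma mem_rotated_region [simp]:
  "(a, b, c) \<in> rotated_region n ws \<longleftrightarrow>
     a + b + c = n \<and> b \<le> length ws \<and> c \<le> count_list (drop b ws) West"
  by (simp add: rotated_region_def)

lemma rotate_region:
  assumes "count_list ws West + 1 = k" "k \<le> n"
  shows "rotate_face ` region n (n - k) ws False = rotated_region n ws"
proof -
  have iff: "n - k < c + count_list (take a ws) South \<longleftrightarrow> b \<le> count_list (drop a ws) West"
    if "a \<le> length ws" "a + b + c = n" for a b c
  proof -
    have "count_list (take a ws) West + count_list (drop a ws) West = count_list ws West"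
      by (metis append_take_drop_id count_list_append)
    then show ?thesis using count_take_West_South[OF that(1)] that(2) assms by linarith
  qed
  show ?thesis
  proof (rule subset_antisym; rule subsetI)
    fix \<alpha> assume "\<alpha> \<in> rotate_face ` region n (n - k) ws False"
    then obtain a b c where "\<alpha> = (c, a, b)" "(a, b, c) \<in> region n (n - k) ws False" by force
    then show "\<alpha> \<in> rotated_region n ws" using iff[of a b c] by (auto split: if_splits)
  next
    fix \<alpha> assume \<alpha>: "\<alpha> \<in> rotated_region n ws"
    obtain c a b where "\<alpha> = (c, a, b)" by (cases \<alpha>)
    then have "(a, b, c) \<in> region n (n - k) ws False" "\<alpha> = rotate_face (a, b, c)"
      using \<alpha> iff[of a b c] by (auto split: if_splits)
    then show "\<alpha> \<in> rotate_face ` region n (n - k) ws False" by blast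
  qed
qed

lemma region_subset: "region n h ws beyond \<subseteq> lattice n"
  by (auto simp: lattice_def)

lemma rotated_region_subset: "rotated_region n ws \<subseteq> lattice n"
  by (auto simp: lattice_def)

lemma finite_region [simp]: "finite (region n h ws beyond)" "finite (rotated_region n ws)"
  by (rule finite_subset[OF region_subset finite_lattice],
      rule finite_subset[OF rotated_region_subset finite_lattice])

lemma face_sum_Un: "finite A \<Longrightarrow> finite B \<Longrightarrow> A \<inter> B = {} \<Longrightarrow> face_sum (A \<union> B) = face_sum A + face_sum B"
  by (simp add: face_sum_def sum.union_disjoint)

lemma count_replicate: "count_list (replicate m x) y = (if x = y then m else 0)"
  by (induction m) auto

text \<open>
  The setting of the exchange. The first path is \<open>p\<close>, then possibly a south step, then \<open>t\<close> west
  steps to the left side; the second one retraces the west steps and goes on with a rotated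
  south step in the case of the south step and with a rotated west step otherwise, and then with
  \<open>q\<close>. At the end of \<open>p\<close> the height is \<open>K + 1\<close>. The two cases differ by the strip of the faces
  at that height between \<open>p\<close> and the left side.
\<close>

context
  fixes n h t K :: nat and p q :: "step list"
  assumes K: "K = count_list q West"
    and h: "count_list p South + K + 1 = h"
    and n: "length p + t + K + 2 = n"
begin

private abbreviation (input) "strip \<equiv> (\<lambda>r. (length p + 1 + r, t - r, K + 1)) ` {..t}"

lemma region_south_west:
  "region n h (p @ South # replicate t West) False = region n h (p @ replicate t West) False \<union> strip"
    (is "?L = ?R")
  and region_south_west_disjoint: "region n h (p @ replicate t West) False \<inter> strip = {}"
proof -
  have row: "(a, b, c) \<in> strip \<longleftrightarrow> a > length p \<and> a \<le> length p + 1 + t \<and> c = K + 1 \<and> a + b + c = n" for a b c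
    using n by (auto simp: image_iff intro!: bexI[of _ "a - length p - 1"])
  have 1: "(a, b, c) \<in> ?L \<longleftrightarrow> a + b + c = n \<and> (if a \<le> length p then h < c + count_list (take a p) South
     else a \<le> length p + 1 + t \<and> K < c)" for a b c
    using h by (auto simp: take_Cons' count_replicate)
  have 2: "(a, b, c) \<in> region n h (p @ replicate t West) False \<longleftrightarrow> a + b + c = n \<and>
     (if a \<le> length p then h < c + count_list (take a p) South
     else a \<le> length p + t \<and> K + 1 < c)" for a b c
    using h by (auto simp: count_replicate)
  show "?L = ?R"
  proof (rule subset_antisym; rule subsetI)
    fix \<alpha> assume "\<alpha> \<in> ?L" then show "\<alpha> \<in> ?R"
      by (cases \<alpha>) (use n in \<open>auto simp only: Un_iff row 1 2 split: if_splits\<close>)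
  next
    fix \<alpha> assume "\<alpha> \<in> ?R" then show "\<alpha> \<in> ?L"
      by (cases \<alpha>) (use n in \<open>auto simp only: Un_iff row 1 2 split: if_splits\<close>)
  qed
  show "region n h (p @ replicate t West) False \<inter> strip = {}"
  proof (rule equals0I)
    fix \<alpha> assume "\<alpha> \<in> region n h (p @ replicate t West) False \<inter> strip"
    then show False by (cases \<alpha>) (auto simp only: Int_iff row 2 split: if_splits)
  qed
qed

lemma rotated_region_west:
  "rotated_region n (replicate t South @ West # q) = rotated_region n (replicate t South @ South # q) \<union> strip"
    (is "?L = ?R")
  and rotated_region_west_disjoint: "rotated_region n (replicate t South @ South # q) \<inter> strip = {}"
proof -
  have row: "(a, b, c) \<in> strip \<longleftrightarrow> b \<le> t \<and> c = K + 1 \<and> a + b + c = n" for a b c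
    using n by (auto simp: image_iff intro!: bexI[of _ "a - length p - 1"])
  have 1: "(a, b, c) \<in> rotated_region n (replicate t South @ s # q) \<longleftrightarrow> a + b + c = n \<and>
     (if b \<le> t then c \<le> K + (if s = West then 1 else 0)
      else b \<le> t + 1 + length q \<and> c \<le> count_list (drop (b - t - 1) q) West)" for a b c s
    using K by (auto simp: drop_Cons' count_replicate)
  show "?L = ?R"
  proof (rule subset_antisym; rule subsetI)
    fix \<alpha> assume "\<alpha> \<in> ?L" then show "\<alpha> \<in> ?R"
      by (cases \<alpha>) (auto simp only: Un_iff row 1 split: if_splits)
  next
    fix \<alpha> assume "\<alpha> \<in> ?R" then show "\<alpha> \<in> ?L"
      by (cases \<alpha>) (auto simp only: Un_iff row 1 split: if_splits)
  qed
  show "rotated_region n (replicate t South @ South # q) \<inter> strip = {}"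
  proof (rule equals0I)
    fix \<alpha> assume "\<alpha> \<in> rotated_region n (replicate t South @ South # q) \<inter> strip"
    then show False by (cases \<alpha>) (auto simp only: Int_iff row 1 split: if_splits)
  qed
qed

text \<open>
  In the columns up to \<open>t\<close> every face near the strip is in exactly one of the two regions. So
  the faces of the strip in the columns before \<open>t\<close> pair to zero with the total, the incoming and
  outgoing neighbours having equal weight. The face in column \<open>t\<close>, the end of the strip, has two
  neighbours in column \<open>t + 1\<close>: the lower one is in a region, the upper one, which is incoming,
  is in none. This missing neighbour is the \<open>- 1\<close>.
\<close>

lemma skew_strip:
  "skew (face_sum (rotated_region n (replicate t South @ West # q))
      + face_sum (region n h (p @ replicate t West) False)) (face_sum strip) = - 1"
proof -
  let ?N = "face_sum (rotated_region n (replicate t South @ West # q))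
      + face_sum (region n h (p @ replicate t West) False)"
  have N: "Poly_Mapping.lookup ?N (a, b, c) = 1" if "a + b + c = n" "a \<ge> length p" "b \<le> t" for a b c
  proof -
    have "(a, b, c) \<in> rotated_region n (replicate t South @ West # q) \<longleftrightarrow> c \<le> K + 1"
      using that K by (auto simp: drop_Cons')
    moreover have "(a, b, c) \<in> region n h (p @ replicate t West) False \<longleftrightarrow> c > K + 1"
      using that n h by (auto simp: count_replicate)
    ultimately show ?thesis by (auto simp: lookup_add lookup_face_sum)
  qed
  have N0: "Poly_Mapping.lookup ?N (length p, t + 1, K + 1) = 0"
    using K h by (auto simp: lookup_add lookup_face_sum)
  have N1: "Poly_Mapping.lookup ?N (length p + 1, t + 1, K) = 1"
    using K h n by (auto simp: lookup_add lookup_face_sum count_replicate take_Cons')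
  have skew_face: "skew ?N (Poly_Mapping.single (length p + 1 + r, t - r, K + 1) 1) = (if r = 0 then - 1 else 0)"
    if "r \<le> t" for r
  proof (cases r)
    case 0
    have "t > 0 \<Longrightarrow> Poly_Mapping.lookup ?N (length p + 1, t - 1, K + 1 + 1) = 1"
      "t > 0 \<Longrightarrow> Poly_Mapping.lookup ?N (length p + 1 + 1, t - 1, K + 1) = 1"
      "Poly_Mapping.lookup ?N (length p + 1 + 1, t, K) = 1"
      "Poly_Mapping.lookup ?N (length p, t, K + 1 + 1) = 1"
      using n by (intro N; simp)+
    then show ?thesis using 0 N0 N1 unfolding skew_single by simp
  next
    case (Suc r')
    have "t - r > 0 \<Longrightarrow> Poly_Mapping.lookup ?N (length p + 1 + r, t - r - 1, K + 1 + 1) = 1"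
      "t - r > 0 \<Longrightarrow> Poly_Mapping.lookup ?N (length p + 1 + r + 1, t - r - 1, K + 1) = 1"
      "Poly_Mapping.lookup ?N (length p + 1 + r + 1, t - r, K) = 1"
      "Poly_Mapping.lookup ?N (length p + r, t - r, K + 1 + 1) = 1"
      "Poly_Mapping.lookup ?N (length p + r, t - r + 1, K + 1) = 1"
      "Poly_Mapping.lookup ?N (length p + 1 + r, t - r + 1, K) = 1"
      using n that Suc by (intro N; simp)+
    then show ?thesis using Suc unfolding skew_single by simp
  qed
  have inj: "inj_on (\<lambda>r. (length p + 1 + r, t - r, K + 1)) {..t}" by (auto intro: inj_onI)
  have "skew ?N (face_sum strip) = (\<Sum>r\<le>t. if r = 0 then - 1 else 0)"
    unfolding face_sum_def[of strip] skew_sum_right sum.reindex[OF inj] by (intro sum.cong refl) (simp only: o_def skew_face atMost_iff)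
  then show ?thesis by simp
qed

lemma
  defines "R1 \<equiv> face_sum (region n h (p @ South # replicate t West) False)"
    and "R2 \<equiv> face_sum (region n h (p @ replicate t West) False)"
    and "L1 \<equiv> face_sum (rotated_region n (replicate t South @ South # q))"
    and "L2 \<equiv> face_sum (rotated_region n (replicate t South @ West # q))"
  shows face_sum_switch: "L1 + R1 = L2 + R2" and skew_switch: "skew L2 R2 = skew L1 R1 + 1"
proof -
  have R: "R1 = R2 + face_sum strip"
    unfolding R1_def R2_def region_south_west
    by (rule face_sum_Un[OF _ _ region_south_west_disjoint]) simp_all
  have L: "L2 = L1 + face_sum strip"
    unfolding L1_def L2_def rotated_region_west
    by (rule face_sum_Un[OF _ _ rotated_region_west_disjoint]) simp_all
  show "L1 + R1 = L2 + R2" unfolding R L by (simp add: ac_simps)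
  have "skew (L2 + R2) (face_sum strip) = - 1" using skew_strip unfolding L2_def R2_def .
  then show "skew L2 R2 = skew L1 R1 + 1"
    using skew_swap[of "face_sum strip" R2]
    unfolding R L skew_add_left skew_add_right skew_self by linarith
qed

end

text \<open>
  If the second path only retraces, its region is the part of the bottom side under the retraced
  steps. Of these faces all but the corner \<open>(n, 0, 0)\<close> have one incoming and one outgoing
  neighbour in the region of the first path; the corner has only an outgoing one, along the
  boundary, which gives \<open>1 / 2\<close>.
\<close>

lemma
  assumes "count_list p South = h" "length p + m + 1 = n"
  shows face_sum_backtrack: "face_sum (rotated_region n (replicate m South)) + face_sum (region n h (p @ replicate m West) False)
      = face_sum (region n h p True)" (is "face_sum ?L + face_sum ?R = face_sum ?U")
    and skew_backtrack: "skew (face_sum (rotated_region n (replicate m South))) (face_sum (region n h (p @ replicate m West) False)) = 1 / 2"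
proof -
  have L: "(a, b, c) \<in> ?L \<longleftrightarrow> a + b + c = n \<and> b \<le> m \<and> c = 0" for a b c
    by (auto simp: count_replicate)
  have R: "(a, b, c) \<in> ?R \<longleftrightarrow> a + b + c = n \<and>
     (if a \<le> length p then h < c + count_list (take a p) South else a \<le> length p + m \<and> 0 < c)" for a b c
    using assms(1) by (auto simp: count_replicate)
  have U: "(a, b, c) \<in> ?U \<longleftrightarrow> a + b + c = n \<and>
     (a \<le> length p \<longrightarrow> h < c + count_list (take a p) South)" for a b c
    by simp
  have le: "count_list (take a p) South \<le> h" for a using count_take_le[of a p South] assms(1) by simp
  have "?U = ?L \<union> ?R"
  proof (rule subset_antisym; rule subsetI)
    fix \<alpha> assume "\<alpha> \<in> ?U" then show "\<alpha> \<in> ?L \<union> ?R"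
      by (cases \<alpha>) (use assms(2) in \<open>auto simp only: Un_iff L R U split: if_splits\<close>)
  next
    fix \<alpha> assume "\<alpha> \<in> ?L \<union> ?R" then show "\<alpha> \<in> ?U"
      by (cases \<alpha>) (use assms(2) in \<open>auto simp only: Un_iff L R U split: if_splits\<close>)
  qed
  moreover have "?L \<inter> ?R = {}"
  proof (rule equals0I)
    fix \<alpha> assume "\<alpha> \<in> ?L \<inter> ?R"
    then show False
      by (cases \<alpha>) (use le in \<open>auto simp only: Int_iff L R not_less[symmetric] add_0 split: if_splits\<close>)
  qed
  ultimately show "face_sum ?L + face_sum ?R = face_sum ?U" by (simp add: face_sum_Un)
  have "?L = (\<lambda>b. (n - b, b, 0 :: nat)) ` {..m}"
  proof (rule subset_antisym; rule subsetI)
    fix \<alpha> assume "\<alpha> \<in> ?L" then show "\<alpha> \<in> (\<lambda>b. (n - b, b, 0 :: nat)) ` {..m}"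
      by (cases \<alpha>) (auto simp only: L image_iff intro!: bexI)
  next
    fix \<alpha> assume "\<alpha> \<in> (\<lambda>b. (n - b, b, 0 :: nat)) ` {..m}"
    then obtain b where "\<alpha> = (n - b, b, 0)" "b \<le> m" by auto
    then show "\<alpha> \<in> ?L" using assms(2) by (simp only: L) simp
  qed
  moreover have inj: "inj_on (\<lambda>b. (n - b, b, 0 :: nat)) {..m}" by (auto intro: inj_onI)
  moreover have "skew (face_sum ?R) (Poly_Mapping.single (n - b, b, 0) 1) = (if b = 0 then - 1 / 2 else 0)"
    if "b \<le> m" for b
  proof -
    have x: "n - b > 0" using that assms(2) by simp
    have no: "Poly_Mapping.lookup (face_sum ?R) (a', b', 0) = 0" for a' b'
      using R[of a' b' 0] le[of a'] by (auto simp: lookup_face_sum simp del: mem_region)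
    have yes: "Poly_Mapping.lookup (face_sum ?R) (a', b', 1) = 1" if "a' \<ge> length p" "a' + b' + 1 = n" for a' b'
      using R[of a' b' 1] that assms by (auto simp: lookup_face_sum simp del: mem_region)
    have "b > 0 \<Longrightarrow> Poly_Mapping.lookup (face_sum ?R) (n - b, b - 1, 1) = 1"
      "Poly_Mapping.lookup (face_sum ?R) (n - b - 1, b, 1) = 1"
      using that assms(2) by (intro yes; simp)+
    then show ?thesis using x no unfolding skew_single by simp
  qed
  ultimately have "skew (face_sum ?R) (face_sum ?L) = (\<Sum>b\<le>m. if b = 0 then - 1 / 2 else 0)"
    unfolding face_sum_def[of ?L] skew_sum_right by (simp add: sum.reindex)
  then show "skew (face_sum ?L) (face_sum ?R) = 1 / 2" by (simp add: skew_swap[of "face_sum ?R"])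
qed

section \<open>Cancellation in a sum over pairs of step sequences\<close>

lemma finite_steps: "finite {ws :: step list. length ws = m}" "finite {ws :: step list. length ws \<le> m}"
proof -
  have "finite (UNIV :: step set)"
    by (rule finite_subset[of _ "{West, South}"]) (auto intro: step.exhaust)
  then show "finite {ws :: step list. length ws = m}" "finite {ws :: step list. length ws \<le> m}"
    using finite_lists_length_eq[of "UNIV :: step set" m] finite_lists_length_le[of "UNIV :: step set" m]
    by simp_all
qed

text \<open>
  Let \<open>X t\<close> be the set of the pairs in which the second path retraces at least \<open>t\<close> steps of the
  first one, without these steps. In it the hypothesis \<open>cancel\<close> matches the pairs whose second
  path begins with \<open>West\<close> and the pairs in which the first path ends with \<open>South\<close> and the second
  one begins with \<open>South\<close>; the others form \<open>X (Suc t)\<close>. The inequality \<open>l \<le> w + h\<close> prevents the first path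
  from being used up too early.
\<close>

lemma sum_pairs_cancel:
  fixes T :: "step list \<Rightarrow> step list \<Rightarrow> 'a :: ab_group_add"
  assumes "l \<le> w + h"
    and cancel: "\<And>t p q. count_list p West + t = w \<Longrightarrow> length q + t + 1 = l \<Longrightarrow>
      count_list p South + count_list q West + 1 = h \<Longrightarrow>
      T (p @ replicate t West) (replicate t South @ West # q)
        + T (p @ South # replicate t West) (replicate t South @ South # q) = 0"
  shows "(\<Sum>(P, Q) | count_list P West = w \<and> length Q = l \<and> count_list P South + count_list Q West = h. T P Q)
    = (\<Sum>p | count_list p West + l = w \<and> count_list p South = h. T (p @ replicate l West) (replicate l South))"
proof -
  define X where "X t = {(p, q). count_list p West + t = w \<and> length q + t = l \<and>
    count_list p South + count_list q West = h}" for t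
  define U where "U t = (\<Sum>(p, q)\<in>X t. T (p @ replicate t West) (replicate t South @ q))" for t
  have fin: "finite (X t)" for t
  proof (rule finite_subset)
    show "X t \<subseteq> {p. length p \<le> w + h} \<times> {q. length q \<le> l}"
    proof (rule subsetI)
      fix x assume "x \<in> X t"
      then obtain p q where "x = (p, q)" "count_list p West + t = w" "length q + t = l"
        "count_list p South + count_list q West = h" by (auto simp: X_def)
      then show "x \<in> {p. length p \<le> w + h} \<times> {q. length q \<le> l}"
        using count_West_South[of p] by auto
    qed
  qed (simp add: finite_steps)
  have "U t = U (Suc t)" if less: "t < l" for t
  proof -
    define Y where "Y = {(p, q). count_list p West + t = w \<and> length q + t + 1 = l \<and>
      count_list p South + count_list q West + 1 = h}"
    define A where "A = (\<lambda>(p, q). (p, West # q)) ` Y"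
    define B where "B = (\<lambda>(p, q). (p @ [South], South # q)) ` Y"
    define C where "C = (\<lambda>(p, q). (p @ [West], South # q)) ` X (Suc t)"
    have "X t \<subseteq> A \<union> B \<union> C"
    proof (rule subsetI)
      fix x assume "x \<in> X t"
      then obtain p q where x: "x = (p, q)" and pq: "count_list p West + t = w" "length q + t = l"
        "count_list p South + count_list q West = h" by (auto simp: X_def)
      obtain s q' where q: "q = s # q'" using pq less by (cases q) auto
      show "x \<in> A \<union> B \<union> C"
      proof (cases s)
        case West
        then have "x \<in> A" using x pq q by (auto simp: A_def Y_def image_iff)
        then show ?thesis by simp
      next
        case South
        have "p \<noteq> []"
        proof
          assume "p = []"
          then show False using pq assms(1) q South count_le_length[of q' West] by auto
        qed
        then obtain p' s' where p: "p = p' @ [s']" by (metis rev_exhaust)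
        show ?thesis
        proof (cases s')
          case West
          then have "x \<in> C" using x pq q p South by (auto simp: C_def X_def image_iff)
          then show ?thesis by simp
        next
          case s': South
          then have "x \<in> B" using x pq q p South by (auto simp: B_def Y_def image_iff)
          then show ?thesis by simp
        qed
      qed
    qed
    moreover have "A \<union> B \<union> C \<subseteq> X t" by (auto simp: A_def B_def C_def X_def Y_def)
    ultimately have X: "X t = A \<union> B \<union> C" by blast
    have finABC: "finite A" "finite B" "finite C" using fin[of t] unfolding X by auto
    have disj: "A \<inter> B = {}" "(A \<union> B) \<inter> C = {}" by (auto simp: A_def B_def C_def)
    let ?T = "\<lambda>(p, q). T (p @ replicate t West) (replicate t South @ q)"
    have "U t = sum ?T A + sum ?T B + sum ?T C"
      unfolding U_def X using finABC disj by (simp add: sum.union_disjoint)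
    moreover have "sum ?T A + sum ?T B = 0"
    proof -
      have inj: "inj_on (\<lambda>(p, q). (p, West # q)) Y" "inj_on (\<lambda>(p, q). (p @ [South], South # q)) Y"
        by (auto simp: inj_on_def)
      show ?thesis
        unfolding A_def B_def sum.reindex[OF inj(1)] sum.reindex[OF inj(2)] sum.distrib[symmetric]
        by (rule sum.neutral) (auto simp: Y_def cancel)
    qed
    moreover have "sum ?T C = U (Suc t)"
    proof -
      have inj: "inj_on (\<lambda>(p, q). (p @ [West], South # q)) (X (Suc t))"
        by (auto simp: inj_on_def)
      show ?thesis
        unfolding C_def sum.reindex[OF inj] U_def
        by (intro sum.cong) (auto simp: replicate_app_Cons_same)
    qed
    ultimately show ?thesis by simp
  qed
  then have "U t = U 0" if "t \<le> l" for t
    using that by (induction t) (simp, metis Suc_le_lessD Suc_leD)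
  then have "U 0 = U l" by (metis order_refl)
  moreover have "X l = (\<lambda>p. (p, [])) ` {p. count_list p West + l = w \<and> count_list p South = h}"
    by (auto simp: X_def)
  then have "U l = (\<Sum>p | count_list p West + l = w \<and> count_list p South = h. T (p @ replicate l West) (replicate l South))"
    unfolding U_def by (simp add: sum.reindex inj_on_def)
  moreover have "U 0 = (\<Sum>(P, Q) | count_list P West = w \<and> length Q = l \<and> count_list P South + count_list Q West = h. T P Q)"
    by (simp add: U_def X_def)
  ultimately show ?thesis by simp
qed

section \<open>Triangular matrices over a ring\<close>

text \<open>
  The injective function \<open>m\<close> gives the order of the indices for which \<open>L\<close> is lower triangular,
  so that upper triangular matrices are covered as well. The inverse \<open>X\<close> is found by forward
  substitution. Since \<open>X\<close> satisfies the hypotheses on \<open>L\<close>, it has a right inverse in turn, which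
  makes it a two-sided inverse of \<open>L\<close>.
\<close>

lemma triangular_right_inverse:
  fixes L :: "nat \<Rightarrow> nat \<Rightarrow> 'a :: ring_1" and m :: "nat \<Rightarrow> nat"
  assumes inj: "inj_on m {..<n}"
    and tri: "\<And>i j. i < n \<Longrightarrow> j < n \<Longrightarrow> m i < m j \<Longrightarrow> L i j = 0"
    and R: "1 \<in> R" "0 \<in> R" "\<And>x y. x \<in> R \<Longrightarrow> y \<in> R \<Longrightarrow> x - y \<in> R" "\<And>x y. x \<in> R \<Longrightarrow> y \<in> R \<Longrightarrow> x * y \<in> R"
      "\<And>i j. i < n \<Longrightarrow> j < n \<Longrightarrow> L i j \<in> R"
    and unit: "\<And>i. i < n \<Longrightarrow> \<exists>u\<in>R. L i i * u = 1 \<and> u * L i i = 1"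
  obtains X where "\<And>i j. i < n \<Longrightarrow> j < n \<Longrightarrow> X i j \<in> R"
    "\<And>i j. i < n \<Longrightarrow> j < n \<Longrightarrow> m i < m j \<Longrightarrow> X i j = 0"
    "\<And>i. i < n \<Longrightarrow> \<exists>u\<in>R. X i i * u = 1 \<and> u * X i i = 1"
    "\<And>i j. i < n \<Longrightarrow> j < n \<Longrightarrow> (\<Sum>k<n. L i k * X k j) = (if i = j then 1 else 0)"
proof -
  obtain d where d: "\<And>i. i < n \<Longrightarrow> d i \<in> R \<and> L i i * d i = 1 \<and> d i * L i i = 1"
    using unit by metis
  have sumR: "(\<Sum>k\<in>K. f k) \<in> R" if "\<And>k. k \<in> K \<Longrightarrow> f k \<in> R" for f :: "nat \<Rightarrow> 'a" and K
  proof -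
    have add: "x + y \<in> R" if "x \<in> R" "y \<in> R" for x y
      using R(3)[OF that(1) R(3)[OF R(2) that(2)]] by simp
    show ?thesis using that by (induction K rule: infinite_finite_induct) (auto simp: R(2) add)
  qed
  define F where "F X i j = d i * ((if i = j then 1 else 0) - (\<Sum>k | k < n \<and> m k < m i. L i k * X k j))"
    for X and i j :: nat
  define X where "X = wfrec (measure m) (\<lambda>X i. \<lambda>j. F X i j)"
  have X: "X i j = F X i j" for i j
  proof -
    have "X i = (\<lambda>j. F (cut X (measure m) i) i j)"
      unfolding X_def by (subst wfrec) simp_all
    also have "\<dots> = (\<lambda>j. F X i j)"
      unfolding F_def by (intro ext arg_cong2[where f = "(*)"] arg_cong2[where f = minus] sum.cong)
        (auto simp: cut_def)
    finally show ?thesis by simp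
  qed
  show thesis
  proof (rule that[of X])
    fix i j assume "i < n" "j < n"
    then show "X i j \<in> R"
    proof (induction i rule: measure_induct_rule[of m])
      case (less i)
      then show ?case
        unfolding X[of i] F_def using d R by (intro R(4) R(3) sumR) auto
    qed
  next
    fix i j assume "i < n" "j < n" "m i < m j"
    then show zero: "X i j = 0"
    proof (induction i rule: measure_induct_rule[of m])
      case (less i)
      then have "i \<noteq> j" "(\<Sum>k | k < n \<and> m k < m i. L i k * X k j) = 0" by (auto intro!: sum.neutral)
      then show ?case unfolding X[of i] F_def by simp
    qed
  next
    have low: "X k j = 0" if "k < n" "j < n" "m k < m j" for k j
      using that
    proof (induction k rule: measure_induct_rule[of m])
      case (less i)
      then have "i \<noteq> j" "(\<Sum>k | k < n \<and> m k < m i. L i k * X k j) = 0" by (auto intro!: sum.neutral)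
      then show ?case unfolding X[of i] F_def by simp
    qed
    fix i assume i: "i < n"
    then have "X i i = d i" unfolding X[of i] F_def by (simp add: low)
    then show "\<exists>u\<in>R. X i i * u = 1 \<and> u * X i i = 1"
      using d[OF i] R(5)[OF i i] by auto
  next
    fix i j assume ij: "i < n" "j < n"
    let ?A = "{k. k < n \<and> m k < m i}" and ?B = "{k. k < n \<and> m i < m k}"
    have split: "{..<n} = insert i (?A \<union> ?B)"
    proof (rule subset_antisym; rule subsetI)
      fix k assume k: "k \<in> {..<n}"
      then have "m k = m i \<Longrightarrow> k = i" using ij(1) inj by (simp add: inj_on_def)
      then show "k \<in> insert i (?A \<union> ?B)" using k by (cases "m k" "m i" rule: linorder_cases) auto
    qed (use ij in auto)
    have disj: "i \<notin> ?A \<union> ?B" "?A \<inter> ?B = {}" "finite ?A" "finite ?B" by auto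
    have "(\<Sum>k<n. L i k * X k j) = L i i * X i j
        + ((\<Sum>k\<in>?A. L i k * X k j) + (\<Sum>k\<in>?B. L i k * X k j))"
      unfolding split using disj by (simp only: sum.insert sum.union_disjoint finite_UnI not_False_eq_True)
    also have "(\<Sum>k | k < n \<and> m i < m k. L i k * X k j) = 0"
      using tri ij by (intro sum.neutral) auto
    also have "L i i * X i j = (if i = j then 1 else 0) - (\<Sum>k | k < n \<and> m k < m i. L i k * X k j)"
      unfolding X[of i] F_def mult.assoc[symmetric] using d[OF ij(1)] by simp
    finally show "(\<Sum>k<n. L i k * X k j) = (if i = j then 1 else 0)" by simp
  qed
qed

section \<open>Monomials in the quantum torus\<close>

lemma monom_add: "monom u \<kappa> + monom v \<kappa> = (monom (u + v) \<kappa> :: 'k::qfield qtorus)"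
  by (simp add: monom_def plus_qtorus.abs_eq eq_onp_def single_add)

lemma monom_0 [simp]: "monom 0 \<kappa> = (0 :: 'k::qfield qtorus)"
  by (simp add: monom_def zero_qtorus_def)

lemma monom_uminus: "monom (- u) \<kappa> = - (monom u \<kappa> :: 'k::qfield qtorus)"
proof -
  have "monom (- u) \<kappa> + monom u \<kappa> = (0 :: 'k qtorus)" by (simp add: monom_add)
  then show ?thesis by (simp add: eq_neg_iff_add_eq_0)
qed

lemma scalar_1: "scalar 1 = (1 :: 'k::qfield qtorus)"
  by (rule Z_zero)

lemma neg_1_power: "(- 1) ^ m = (scalar ((- 1) ^ m) :: 'k::qfield qtorus)"
  by (induction m) (simp_all add: scalar_1 monom_uminus)

lemma scalar_mult: "scalar u * monom v \<kappa> = (monom (u * v) \<kappa> :: 'k::qfield qtorus)"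
  by (simp add: monom_mult)

lemma qpow_mult_minus: "qpow r * qpow (- r) = (1 :: 'k::qfield)"
  by (simp flip: qpow_add)

lemma qpow_nonzero: "qpow r \<noteq> (0 :: 'k::qfield)"
  using qpow_mult_minus[of r, where 'k = 'k] by auto

lemma monom_inverse:
  assumes "u \<noteq> 0"
  shows "monom u \<kappa> * monom (1 / u) (- \<kappa>) = (1 :: 'k::qfield qtorus)"
    "monom (1 / u) (- \<kappa>) * monom u \<kappa> = (1 :: 'k::qfield qtorus)"
  using assms by (simp_all add: monom_mult skew_uminus_right skew_swap[of "- \<kappa>" \<kappa>] scalar_1)

section \<open>The quantum torus of the triangle as a subring\<close>

lemma keys_coeffs_monom: "Poly_Mapping.keys (coeffs (monom u \<kappa>)) \<subseteq> {\<kappa>}"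
  by (simp add: monom_def Abs_qtorus_inverse)

lemma monom_in_quantum_torus:
  "Poly_Mapping.keys \<kappa> \<subseteq> lattice n \<Longrightarrow> monom u \<kappa> \<in> quantum_torus n"
  using keys_coeffs_monom[of u \<kappa>] by (auto simp: quantum_torus_def)

lemma quantum_torus_0: "0 \<in> quantum_torus n"
  using monom_in_quantum_torus[of 0 n 0] by simp

lemma quantum_torus_1: "1 \<in> quantum_torus n"
  using monom_in_quantum_torus[of 0 n 1] by (simp add: scalar_1)

lemma quantum_torus_add: "x \<in> quantum_torus n \<Longrightarrow> y \<in> quantum_torus n \<Longrightarrow> x + y \<in> quantum_torus n"
  using keys_add[of "coeffs x" "coeffs y"] by (auto simp: quantum_torus_def plus_qtorus.rep_eq)

lemma quantum_torus_diff: "x \<in> quantum_torus n \<Longrightarrow> y \<in> quantum_torus n \<Longrightarrow> x - y \<in> quantum_torus n"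
  using keys_diff[of "coeffs x" "coeffs y"] by (auto simp: quantum_torus_def minus_qtorus.rep_eq)

lemma quantum_torus_sum: "(\<And>a. a \<in> A \<Longrightarrow> f a \<in> quantum_torus n) \<Longrightarrow> sum f A \<in> quantum_torus n"
  by (induction A rule: infinite_finite_induct) (auto simp: quantum_torus_0 quantum_torus_add)

lemma qtorus_expand:
  "x = (\<Sum>\<kappa>\<in>Poly_Mapping.keys (coeffs x). monom (Poly_Mapping.lookup (coeffs x) \<kappa>) \<kappa>)"
proof -
  have sum: "coeffs (sum f A) = (\<Sum>a\<in>A. coeffs (f a))" for f :: "exponent \<Rightarrow> 'a qtorus" and A
    by (induction A rule: infinite_finite_induct) (simp_all add: zero_qtorus.rep_eq plus_qtorus.rep_eq)
  have "coeffs x = (\<Sum>\<kappa>\<in>Poly_Mapping.keys (coeffs x). Poly_Mapping.single \<kappa> (Poly_Mapping.lookup (coeffs x) \<kappa>))"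
    by (rule poly_mapping_eqI)
      (auto simp: lookup_sum lookup_single when_def sum.delta in_keys_iff)
  also have "\<dots> = coeffs (\<Sum>\<kappa>\<in>Poly_Mapping.keys (coeffs x). monom (Poly_Mapping.lookup (coeffs x) \<kappa>) \<kappa>)"
    by (simp add: sum monom_def Abs_qtorus_inverse)
  finally show ?thesis by (simp add: coeffs_inject)
qed

lemma quantum_torus_mult:
  assumes "x \<in> quantum_torus n" "y \<in> quantum_torus n"
  shows "x * y \<in> quantum_torus n"
proof -
  have "monom u \<kappa> * monom v \<mu> \<in> quantum_torus n"
    if "\<kappa> \<in> Poly_Mapping.keys (coeffs x)" "\<mu> \<in> Poly_Mapping.keys (coeffs y)" for u v \<kappa> \<mu>
  proof -
    have "Poly_Mapping.keys \<kappa> \<subseteq> lattice n" "Poly_Mapping.keys \<mu> \<subseteq> lattice n"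
      using that assms unfolding quantum_torus_def by blast+
    then show ?thesis
      unfolding monom_mult using keys_add[of \<kappa> \<mu>] by (intro monom_in_quantum_torus) blast
  qed
  then show ?thesis
    by (subst qtorus_expand[of x], subst qtorus_expand[of y])
      (auto simp: sum_product intro!: quantum_torus_sum)
qed

section \<open>Rotation\<close>

lemma rotate_exponent_add: "rotate_exponent (\<kappa> + \<mu>) = rotate_exponent \<kappa> + rotate_exponent \<mu>"
  unfolding rotate_exponent_def by (rule setsum_keys_plus_distrib) (simp_all add: single_add)

lemma rotate_exponent_0 [simp]: "rotate_exponent 0 = 0"
  by (simp add: rotate_exponent_def)

lemma rotate_exponent_uminus: "rotate_exponent (- \<kappa>) = - rotate_exponent \<kappa>"
proof -
  have "rotate_exponent (- \<kappa>) + rotate_exponent \<kappa> = 0" by (simp flip: rotate_exponent_add)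
  then show ?thesis by (simp add: eq_neg_iff_add_eq_0)
qed

lemma rotate_exponent_single:
  "rotate_exponent (Poly_Mapping.single \<alpha> r) = Poly_Mapping.single (rotate_face \<alpha>) r"
  by (simp add: rotate_exponent_def)

lemma rotate_exponent_sum: "rotate_exponent (sum f A) = (\<Sum>a\<in>A. rotate_exponent (f a))"
  by (induction A rule: infinite_finite_induct) (simp_all add: rotate_exponent_add)

lemma inj_rotate_face: "inj rotate_face"
proof (rule injI)
  fix \<alpha> \<beta> assume "rotate_face \<alpha> = rotate_face \<beta>"
  then show "\<alpha> = \<beta>" by (cases \<alpha>; cases \<beta>) auto
qed

lemma rotate_exponent_face_sum: "rotate_exponent (face_sum A) = face_sum (rotate_face ` A)"
  using inj_on_subset[OF inj_rotate_face, of A]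
  by (simp add: face_sum_def rotate_exponent_sum rotate_exponent_single sum.reindex)

lemma rotate_exponent_D1: "rotate_exponent (D1_exponent n) = D2_exponent n"
proof -
  have "bij_betw rotate_face (lattice n) (lattice n)"
  proof (rule bij_betwI)
    show "rotate_face \<in> lattice n \<rightarrow> lattice n" "(\<lambda>(a, b, c). (b, c, a)) \<in> lattice n \<rightarrow> lattice n"
      by (auto simp: lattice_def)
  qed auto
  then have "D2_exponent n = (\<Sum>\<alpha>\<in>lattice n. case rotate_face \<alpha> of (a, b, c) \<Rightarrow>
      Poly_Mapping.single (a, b, c) (of_nat a / of_nat n))"
    unfolding D2_exponent_def by (rule sum.reindex_bij_betw[symmetric])
  then show ?thesis
    unfolding D1_exponent_def rotate_exponent_sum
    by (auto simp: rotate_exponent_single intro!: sum.cong)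
qed

lemma rotate_add: "rotate (x + y) = rotate x + (rotate y :: 'k::qfield qtorus)"
  unfolding rotate_def plus_qtorus.rep_eq
  by (rule setsum_keys_plus_distrib) (simp_all add: monom_add)

lemma rotate_0 [simp]: "rotate 0 = (0 :: 'k::qfield qtorus)"
  by (simp add: rotate_def zero_qtorus.rep_eq)

lemma rotate_sum: "rotate (sum f A) = (\<Sum>a\<in>A. rotate (f a) :: 'k::qfield qtorus)"
  by (induction A rule: infinite_finite_induct) (simp_all add: rotate_add)

lemma rotate_monom: "rotate (monom u \<kappa>) = (monom u (rotate_exponent \<kappa>) :: 'k::qfield qtorus)"
proof (cases "u = 0")
  case False
  then show ?thesis by (simp add: rotate_def monom_def Abs_qtorus_inverse)
qed simp

section \<open>The entries of the transport matrices\<close>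

definition left_steps :: "nat \<Rightarrow> nat \<Rightarrow> step list set" where
  "left_steps j i = {ws. count_list ws West + 1 = j \<and> length ws + 1 = i}"

definition bottom_steps :: "nat \<Rightarrow> nat \<Rightarrow> nat \<Rightarrow> step list set" where
  "bottom_steps n j i = {ws. count_list ws West + i = j \<and> count_list ws South + j = n}"

text \<open>
  The admissible step sequences are singled out by where they end: the column \<open>b = 0\<close> for a left
  sink and the height \<open>c = 0\<close> for a bottom sink.
\<close>

lemma calM1_entry:
  assumes "1 \<le> j" "j \<le> n" "1 \<le> i" "i \<le> n"
  shows "(\<Sum>P\<in>paths n (Source j) (LeftSink i). weight n P) =
    (\<Sum>ws\<in>left_steps j i. Z (face_sum (region n (n - j) ws False)) :: 'k::qfield qtorus)"
proof -
  let ?valid = "\<lambda>ws. count_list ws West \<le> j - 1 \<and> count_list ws South \<le> n - j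
      \<and> (end_white 0 (j-1) (n-j) ws, LeftSink i) \<in> network_arcs n"
  have steps: "Collect ?valid = left_steps j i"
  proof (rule subset_antisym; rule subsetI)
    fix ws assume "ws \<in> Collect ?valid"
    then show "ws \<in> left_steps j i" using assms by (auto simp: network_arcs_def left_steps_def)
  next
    fix ws assume "ws \<in> left_steps j i"
    then have ws: "count_list ws West + 1 = j" "length ws + 1 = i" by (auto simp: left_steps_def)
    have "count_list ws West + count_list ws South = length ws" by (rule count_West_South)
    then have "n - j - count_list ws South = n - i" "count_list ws South \<le> n - j"
      using ws assms by auto
    then show "ws \<in> Collect ?valid"
      using ws assms by (auto simp: network_arcs_def)
  qed
  have sink: "(LeftSink i \<in> range BottomSink) = False" by auto
  have paths: "paths n (Source j) (LeftSink i) = (\<lambda>ws. step_path n j ws (LeftSink i)) ` Collect ?valid"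
    by (rule paths_to_sink[OF assms(1,2)]) simp
  have "(\<Sum>P\<in>paths n (Source j) (LeftSink i). weight n P) =
    (\<Sum>ws\<in>Collect ?valid. weight n (step_path n j ws (LeftSink i)) :: 'k qtorus)"
    unfolding paths sum.reindex[OF inj_on_step_path] by (simp only: o_def)
  also have "\<dots> = (\<Sum>ws\<in>Collect ?valid. Z (face_sum (region n (n - j) ws False)))"
    using right_faces_step_path[OF assms(1,2), of "LeftSink i"] sink
    by (intro sum.cong refl) (auto simp: weight_def face_sum_def)
  finally show ?thesis unfolding steps .
qed

lemma calM2_entry:
  assumes "1 \<le> j" "j \<le> n" "1 \<le> i" "i \<le> n"
  shows "(\<Sum>P\<in>paths n (Source j) (BottomSink i). weight n P) =
    (\<Sum>ws\<in>bottom_steps n j i. Z (face_sum (region n (n - j) ws True)) :: 'k::qfield qtorus)"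
proof -
  let ?valid = "\<lambda>ws. count_list ws West \<le> j - 1 \<and> count_list ws South \<le> n - j
      \<and> (end_white 0 (j-1) (n-j) ws, BottomSink i) \<in> network_arcs n"
  have steps: "Collect ?valid = bottom_steps n j i"
  proof (rule subset_antisym; rule subsetI)
    fix ws assume "ws \<in> Collect ?valid"
    then show "ws \<in> bottom_steps n j i" using assms by (auto simp: network_arcs_def bottom_steps_def)
  next
    fix ws assume "ws \<in> bottom_steps n j i"
    then have ws: "count_list ws West + i = j" "count_list ws South + j = n" by (auto simp: bottom_steps_def)
    have "count_list ws West + count_list ws South = length ws" by (rule count_West_South)
    then have "length ws = n - i" "j - 1 - count_list ws West = i - 1"
      using ws assms by auto
    then show "ws \<in> Collect ?valid"
      using ws assms by (auto simp: network_arcs_def)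
  qed
  have sink: "(BottomSink i \<in> range BottomSink) = True" by auto
  have paths: "paths n (Source j) (BottomSink i) = (\<lambda>ws. step_path n j ws (BottomSink i)) ` Collect ?valid"
    by (rule paths_to_sink[OF assms(1,2)]) simp
  have "(\<Sum>P\<in>paths n (Source j) (BottomSink i). weight n P) =
    (\<Sum>ws\<in>Collect ?valid. weight n (step_path n j ws (BottomSink i)) :: 'k qtorus)"
    unfolding paths sum.reindex[OF inj_on_step_path] by (simp only: o_def)
  also have "\<dots> = (\<Sum>ws\<in>Collect ?valid. Z (face_sum (region n (n - j) ws True)))"
    using right_faces_step_path[OF assms(1,2), of "BottomSink i"] sink
    by (intro sum.cong refl) (auto simp: weight_def face_sum_def)
  finally show ?thesis unfolding steps .
qed

text \<open>The scalar that \<open>Qmat n * Smat n\<close> puts in front of row \<open>i\<close>, with \<open>i\<close> starting at 1.\<close>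

definition qs_coeff :: "nat \<Rightarrow> 'k::qfield" where
  "qs_coeff i = (- 1) ^ (i + 1) * qpow (1 / 2 - of_nat i)"

lemma QS_carrier:
  assumes "A \<in> carrier_mat n n"
  shows "Qmat n * Smat n * A \<in> carrier_mat n n"
proof -
  have "Qmat n \<in> carrier_mat n n" "Smat n \<in> carrier_mat n n"
    by (simp_all add: Qmat_def Smat_def mat1_def)
  then show ?thesis using assms by (intro mult_carrier_mat)
qed

lemma QS_entry:
  assumes "i < n" "j < n" "A \<in> carrier_mat n n"
  shows "(Qmat n * Smat n * A) $$ (i, j) = scalar (qs_coeff (Suc i)) * (A $$ (n - 1 - i, j) :: 'k::qfield qtorus)"
proof -
  have dims: "(Qmat n :: 'k qtorus mat) \<in> carrier_mat n n" "(Smat n :: 'k qtorus mat) \<in> carrier_mat n n"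
    by (simp_all add: Qmat_def Smat_def mat1_def)
  have QS: "(Qmat n * Smat n) $$ (i, k) =
      (if k = n - 1 - i then scalar (qs_coeff (Suc i)) else (0 :: 'k qtorus))" if "k < n" for k
  proof -
    have "(Qmat n * Smat n) $$ (i, k) = (\<Sum>l<n. Qmat n $$ (i, l) * (Smat n $$ (l, k) :: 'k qtorus))"
      using assms that carrier_matD[OF dims(1)] carrier_matD[OF dims(2)] by (simp add: scalar_prod_def atLeast0LessThan)
    also have "\<dots> = (\<Sum>l<n. if l = i then scalar (qpow (1 / 2 - of_nat (Suc i))) * Smat n $$ (i, k) else 0)"
      using assms by (intro sum.cong refl) (auto simp: Qmat_def mat1_def)
    also have "\<dots> = scalar (qpow (1 / 2 - of_nat (Suc i))) * Smat n $$ (i, k)"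
      using assms by simp
    also have "Smat n $$ (i, k) = (if k = n - 1 - i then scalar ((- 1) ^ (Suc i + 1)) else (0 :: 'k qtorus))"
      using assms that by (auto simp: Smat_def mat1_def neg_1_power simp del: power_Suc)
    finally show ?thesis by (auto simp: scalar_mult qs_coeff_def mult.commute)
  qed
  have "(Qmat n * Smat n * A) $$ (i, j) = (\<Sum>k<n. (Qmat n * Smat n) $$ (i, k) * A $$ (k, j))"
    using assms carrier_matD[OF dims(1)] carrier_matD[OF dims(2)] by (simp add: scalar_prod_def atLeast0LessThan)
  also have "\<dots> = (\<Sum>k<n. if k = n - 1 - i then scalar (qs_coeff (Suc i)) * A $$ (n - 1 - i, j) else 0)"
    by (intro sum.cong refl) (simp add: QS)
  also have "\<dots> = scalar (qs_coeff (Suc i)) * A $$ (n - 1 - i, j)"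
    using assms by simp
  finally show ?thesis .
qed

lemma finite_left_steps [simp]: "finite (left_steps j i)"
  by (rule finite_subset[OF _ finite_steps(1)[of "i - 1"]]) (auto simp: left_steps_def)

lemma skew_uminus_left: "skew (- \<kappa>) \<mu> = - skew \<kappa> \<mu>"
  using skew_uminus_right[of \<mu> \<kappa>] skew_swap[of "- \<kappa>" \<mu>] skew_swap[of \<kappa> \<mu>] by simp

lemma skew_diff_left: "skew (\<kappa> - \<kappa>') \<mu> = skew \<kappa> \<mu> - skew \<kappa>' \<mu>"
  using skew_add_left[of \<kappa> "- \<kappa>'" \<mu>] by (simp add: skew_uminus_left)

lemma skew_diff_right: "skew \<mu> (\<kappa> - \<kappa>') = skew \<mu> \<kappa> - skew \<mu> \<kappa>'"
  using skew_add_right[of \<mu> \<kappa> "- \<kappa>'"] by (simp add: skew_uminus_right)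

lemma M_carrier:
  "(M1 n :: 'k::qfield qtorus mat) \<in> carrier_mat n n"
  "(M2 n :: 'k::qfield qtorus mat) \<in> carrier_mat n n"
  "(M3 n :: 'k::qfield qtorus mat) \<in> carrier_mat n n"
proof -
  have "(calM1 n :: 'k qtorus mat) \<in> carrier_mat n n" "(calM2 n :: 'k qtorus mat) \<in> carrier_mat n n"
    by (simp_all add: calM1_def calM2_def mat1_def)
  from this[THEN QS_carrier] show "(M1 n :: 'k qtorus mat) \<in> carrier_mat n n"
    "(M2 n :: 'k qtorus mat) \<in> carrier_mat n n" "(M3 n :: 'k qtorus mat) \<in> carrier_mat n n"
    unfolding M1_def M2_def M3_def by (simp_all only: map_carrier_mat)
qed

text \<open>
  The region of a path to a left sink contains neither \<open>(n, 0, 0)\<close> nor \<open>(0, n, 0)\<close>, so its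
  weight commutes with \<open>D\<^sub>1\<close>, and moving \<open>D\<^sub>1\<close> into the exponent costs no power of \<open>q\<close>. In
  \<open>M2 n\<close> it does: there the corners \<open>(n, 0, 0)\<close> and \<open>(0, 0, n)\<close> and the pairing of \<open>D\<^sub>1\<close> with
  \<open>D\<^sub>2\<close> contribute.
\<close>

lemma M1_entry:
  assumes "i < n" "j < n"
  shows "M1 n $$ (i, j) = (\<Sum>ws\<in>left_steps (Suc j) (n - i).
    monom (qs_coeff (Suc i)) (face_sum (region n (n - Suc j) ws False) - D1_exponent n) :: 'k::qfield qtorus)"
proof -
  have calM1: "(calM1 n :: 'k qtorus mat) \<in> carrier_mat n n" by (simp add: calM1_def mat1_def)
  have "M1 n $$ (i, j) = scalar (qs_coeff (Suc i)) * (calM1 n $$ (n - 1 - i, j)) * (D1_inv n :: 'k qtorus)"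
    using assms QS_entry[OF assms calM1] carrier_matD[OF QS_carrier[OF calM1]]
    by (simp add: M1_def)
  also have "calM1 n $$ (n - 1 - i, j) = (\<Sum>ws\<in>left_steps (Suc j) (n - i).
      Z (face_sum (region n (n - Suc j) ws False)) :: 'k qtorus)"
    using assms calM1_entry[of "Suc j" n "n - i", where 'k = 'k]
    by (simp add: calM1_def mat1_def Suc_diff_Suc)
  finally have "M1 n $$ (i, j) = (\<Sum>ws\<in>left_steps (Suc j) (n - i).
      scalar (qs_coeff (Suc i)) * Z (face_sum (region n (n - Suc j) ws False)) * (Z (- D1_exponent n) :: 'k qtorus))"
    by (simp add: sum_distrib_left sum_distrib_right D1_inv_def)
  also have "\<dots> = (\<Sum>ws\<in>left_steps (Suc j) (n - i).
    monom (qs_coeff (Suc i)) (face_sum (region n (n - Suc j) ws False) - D1_exponent n))"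
  proof (rule sum.cong[OF refl])
    fix ws assume "ws \<in> left_steps (Suc j) (n - i)"
    then have "length ws < n" using assms by (auto simp: left_steps_def)
    then have "skew (D1_exponent n) (face_sum (region n (n - Suc j) ws False)) = 0"
      using skew_D1_face_sum[OF region_subset] assms by simp
    then have "skew (face_sum (region n (n - Suc j) ws False)) (- D1_exponent n) = 0"
      by (simp add: skew_uminus_right skew_swap[of "face_sum _"])
    then show "scalar (qs_coeff (Suc i)) * Z (face_sum (region n (n - Suc j) ws False)) * (Z (- D1_exponent n) :: 'k qtorus)
      = monom (qs_coeff (Suc i)) (face_sum (region n (n - Suc j) ws False) - D1_exponent n)"
      by (simp add: monom_mult)
  qed
  finally show ?thesis .
qed

lemma M3_entry:
  assumes "i < n" "j < n"
  shows "M3 n $$ (i, j) = (\<Sum>ws\<in>left_steps (Suc j) (n - i).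
    monom (qs_coeff (Suc i)) (face_sum (rotated_region n ws) - D2_exponent n) :: 'k::qfield qtorus)"
proof -
  have "M3 n $$ (i, j) = rotate (M1 n $$ (i, j) :: 'k qtorus)"
    using assms carrier_matD[OF M_carrier(1)[of n, where 'k = 'k]] by (simp add: M3_def)
  also have "\<dots> = (\<Sum>ws\<in>left_steps (Suc j) (n - i).
    monom (qs_coeff (Suc i)) (rotate_exponent (face_sum (region n (n - Suc j) ws False) + (- D1_exponent n))))"
    by (simp add: M1_entry[OF assms] rotate_sum rotate_monom)
  also have "\<dots> = (\<Sum>ws\<in>left_steps (Suc j) (n - i).
    monom (qs_coeff (Suc i)) (face_sum (rotated_region n ws) - D2_exponent n))"
    unfolding rotate_exponent_add rotate_exponent_uminus rotate_exponent_D1 rotate_exponent_face_sum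
    using assms by (intro sum.cong refl) (simp add: rotate_region left_steps_def)
  finally show ?thesis .
qed

lemma M2_entry:
  assumes "i < n" "j < n"
  shows "M2 n $$ (i, j) = (\<Sum>ws\<in>bottom_steps n (Suc j) (n - i).
    monom (qs_coeff (Suc i) * qpow (- (1 / (2 * of_nat n))))
      (face_sum (region n (n - Suc j) ws True) - D1_exponent n - D2_exponent n) :: 'k::qfield qtorus)"
proof -
  have calM2: "(calM2 n :: 'k qtorus mat) \<in> carrier_mat n n" by (simp add: calM2_def mat1_def)
  have "M2 n $$ (i, j) = scalar (qs_coeff (Suc i)) * (calM2 n $$ (n - 1 - i, j)) * D1_inv n * (D2_inv n :: 'k qtorus)"
    using assms QS_entry[OF assms calM2] carrier_matD[OF QS_carrier[OF calM2]]
    by (simp add: M2_def)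
  also have "calM2 n $$ (n - 1 - i, j) = (\<Sum>ws\<in>bottom_steps n (Suc j) (n - i).
      Z (face_sum (region n (n - Suc j) ws True)) :: 'k qtorus)"
    using assms calM2_entry[of "Suc j" n "n - i", where 'k = 'k]
    by (simp add: calM2_def mat1_def Suc_diff_Suc)
  finally have "M2 n $$ (i, j) = (\<Sum>ws\<in>bottom_steps n (Suc j) (n - i).
      scalar (qs_coeff (Suc i)) * Z (face_sum (region n (n - Suc j) ws True))
        * Z (- D1_exponent n) * (Z (- D2_exponent n) :: 'k qtorus))"
    by (simp add: sum_distrib_left sum_distrib_right D1_inv_def D2_inv_def)
  also have "\<dots> = (\<Sum>ws\<in>bottom_steps n (Suc j) (n - i).
    monom (qs_coeff (Suc i) * qpow (- (1 / (2 * of_nat n))))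
      (face_sum (region n (n - Suc j) ws True) - D1_exponent n - D2_exponent n))"
  proof (rule sum.cong[OF refl])
    fix ws assume "ws \<in> bottom_steps n (Suc j) (n - i)"
    then have "length ws < n" using assms count_West_South[of ws] by (auto simp: bottom_steps_def)
    let ?R = "face_sum (region n (n - Suc j) ws True)"
    have D1: "skew ?R (D1_exponent n) = 1 / (2 * of_nat n)"
      using skew_D1_face_sum[OF region_subset, of n "n - Suc j" ws True] assms \<open>length ws < n\<close>
      by (simp add: skew_swap[of ?R])
    have D2: "skew ?R (D2_exponent n) = - (1 / (2 * of_nat n))"
      using skew_D2_face_sum[OF region_subset, of n "n - Suc j" ws True] assms
      by (simp add: skew_swap[of ?R])
    have D12: "skew (D1_exponent n) (D2_exponent n) = - (1 / (2 * of_nat n))"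
      using skew_D1_D2[of n] assms by simp
    have "scalar (qs_coeff (Suc i)) * Z ?R * Z (- D1_exponent n) * (Z (- D2_exponent n) :: 'k qtorus)
      = monom (qs_coeff (Suc i) * qpow (skew ?R (- D1_exponent n) + skew (?R - D1_exponent n) (- D2_exponent n)))
         (?R - D1_exponent n - D2_exponent n)"
      by (simp add: monom_mult qpow_add mult_ac)
    also have "skew ?R (- D1_exponent n) + skew (?R - D1_exponent n) (- D2_exponent n) = - (1 / (2 * of_nat n))"
      unfolding skew_uminus_right skew_diff_left D1 D2 D12 by simp
    finally show "scalar (qs_coeff (Suc i)) * Z ?R * Z (- D1_exponent n) * (Z (- D2_exponent n) :: 'k qtorus)
      = monom (qs_coeff (Suc i) * qpow (- (1 / (2 * of_nat n)))) (?R - D1_exponent n - D2_exponent n)" .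
  qed
  finally show ?thesis .
qed

text \<open>
  The contribution of a pair of paths to an entry of \<open>M3 n * M1 n\<close>, up to the scalar of the row.
  The summand \<open>- 1 / (2 * of_nat n)\<close> collects the pairings with \<open>D\<^sub>1\<close> and \<open>D\<^sub>2\<close>; it does not
  depend on the pair.
\<close>

definition pair_term :: "nat \<Rightarrow> nat \<Rightarrow> step list \<Rightarrow> step list \<Rightarrow> 'k::qfield qtorus" where
  "pair_term n h P Q = monom (qs_coeff (Suc (count_list Q West))
       * qpow (skew (face_sum (rotated_region n Q)) (face_sum (region n h P False)) - 1 / (2 * of_nat n)))
     (face_sum (rotated_region n Q) + face_sum (region n h P False) - D1_exponent n - D2_exponent n)"

lemma entry_product:
  assumes "length Q < n" "length P < n" "h < n" "k = Suc (count_list Q West)"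
  shows "monom u (face_sum (rotated_region n Q) - D2_exponent n)
      * monom (qs_coeff k) (face_sum (region n h P False) - D1_exponent n)
    = scalar u * (pair_term n h P Q :: 'k::qfield qtorus)"
proof -
  let ?L = "face_sum (rotated_region n Q)" and ?R = "face_sum (region n h P False)"
  have D1: "skew ?L (D1_exponent n) = 1 / (2 * of_nat n)"
    using skew_D1_face_sum[OF rotated_region_subset, of n Q] assms by (simp add: skew_swap[of ?L])
  have D2: "skew (D2_exponent n) ?R = 1 / (2 * of_nat n)"
    using skew_D2_face_sum[OF region_subset, of n h P False] assms by simp
  have D21: "skew (D2_exponent n) (D1_exponent n) = 1 / (2 * of_nat n)"
    using skew_D1_D2[of n] assms by (simp add: skew_swap[of "D2_exponent n"])
  have "skew (?L - D2_exponent n) (?R - D1_exponent n) = skew ?L ?R - 1 / (2 * of_nat n)"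
    unfolding skew_diff_left skew_diff_right D1 D2 D21 by simp
  then have skew: "skew (?L - D2_exponent n) (?R - D1_exponent n) = skew ?L ?R - 1 / (2 * of_nat n)" .
  have exponent: "?L - D2_exponent n + (?R - D1_exponent n) = ?L + ?R - D1_exponent n - D2_exponent n"
    by (simp add: algebra_simps)
  then show ?thesis
    unfolding pair_term_def assms(4) monom_mult skew exponent by (simp add: mult_ac)
qed

text \<open>
  The meeting point of the paths of a pair is determined by the number of rotated west steps. If
  it moves by one, the sign of \<open>Smat\<close> changes, and the power of \<open>q\<close> in \<open>Qmat\<close> makes up for the
  change of the skew pairing in \<open>skew_switch\<close>.
\<close>

lemma qs_coeff_Suc: "qs_coeff (Suc i) * qpow (r + 1) = - (qs_coeff i * qpow r :: 'k::qfield)"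
proof -
  have "1 / 2 - of_nat (Suc i) + (r + 1) = 1 / 2 - of_nat i + r" by simp
  then have "qpow (1 / 2 - of_nat (Suc i)) * qpow (r + 1) = (qpow (1 / 2 - of_nat i) * qpow r :: 'k)"
    by (metis qpow_add)
  then show ?thesis by (simp add: qs_coeff_def mult.assoc)
qed

lemma pair_term_cancel:
  assumes "count_list p South + count_list q West + 1 = h" "length p + t + count_list q West + 2 = n"
  shows "pair_term n h (p @ replicate t West) (replicate t South @ West # q)
    + pair_term n h (p @ South # replicate t West) (replicate t South @ South # q) = (0 :: 'k::qfield qtorus)"
proof -
  have skew: "skew (face_sum (rotated_region n (replicate t South @ West # q))) (face_sum (region n h (p @ replicate t West) False))
     - 1 / (2 * of_nat n) = (skew (face_sum (rotated_region n (replicate t South @ South # q)))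
       (face_sum (region n h (p @ South # replicate t West) False)) - 1 / (2 * of_nat n)) + 1"
    using skew_switch[OF refl assms] by simp
  have count: "count_list (replicate t South @ West # q) West = Suc (count_list (replicate t South @ South # q) West)"
    by simp
  show ?thesis
    unfolding pair_term_def skew count qs_coeff_Suc face_sum_switch[OF refl assms]
    by (simp add: monom_uminus)
qed

lemma pair_term_backtrack:
  assumes "count_list p South = h" "length p + m + 1 = n"
  shows "pair_term n h (p @ replicate m West) (replicate m South)
    = (monom (qpow (- (1 / (2 * of_nat n)))) (face_sum (region n h p True) - D1_exponent n - D2_exponent n) :: 'k::qfield qtorus)"
proof -
  have "qs_coeff (Suc 0) * qpow (1 / 2 - 1 / (2 * of_nat n)) = (qpow (- (1 / (2 * of_nat n))) :: 'k)"
    by (simp add: qs_coeff_def flip: qpow_add)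
  then show ?thesis
    unfolding pair_term_def face_sum_backtrack[OF assms] skew_backtrack[OF assms]
    by (simp add: count_replicate)
qed

text \<open>
  The summation index \<open>k\<close> of the matrix product is the common position on the left side. It is
  determined by the second path, so the product runs over all pairs with the right total number
  of steps.
\<close>

lemma M3_times_M1: "M3 n * M1 n = (M2 n :: 'k::qfield qtorus mat)"
proof (rule eq_matI)
  note dims = M_carrier[of n, where 'k = 'k, THEN carrier_matD(1)]
    M_carrier[of n, where 'k = 'k, THEN carrier_matD(2)]
  show "dim_row (M3 n * M1 n :: 'k qtorus mat) = dim_row (M2 n :: 'k qtorus mat)"
    "dim_col (M3 n * M1 n :: 'k qtorus mat) = dim_col (M2 n :: 'k qtorus mat)"
    by (simp_all add: dims)
  fix i j assume "i < dim_row (M2 n :: 'k qtorus mat)" "j < dim_col (M2 n :: 'k qtorus mat)"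
  then have ij: "i < n" "j < n" by (simp_all add: dims)
  define h where "h = n - Suc j"
  define l where "l = n - Suc i"
  let ?u = "qs_coeff (Suc i) :: 'k"
  let ?X = "{(P, Q). count_list P West = j \<and> length Q = l \<and> count_list P South + count_list Q West = h}"
  have X: "?X = (\<Union>k<n. left_steps (Suc j) (n - k) \<times> left_steps (Suc k) (n - i))"
  proof (rule subset_antisym; rule subsetI)
    fix x assume "x \<in> ?X"
    then obtain P Q where x: "x = (P, Q)" "count_list P West = j" "length Q = l"
      "count_list P South + count_list Q West = h" by auto
    then have "count_list Q West < n" "length P + 1 = n - count_list Q West"
      using count_West_South[of P] count_le_length[of Q West] ij by (auto simp: h_def l_def)
    then show "x \<in> (\<Union>k<n. left_steps (Suc j) (n - k) \<times> left_steps (Suc k) (n - i))"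
      using x ij by (auto simp: left_steps_def l_def)
  next
    fix x assume "x \<in> (\<Union>k<n. left_steps (Suc j) (n - k) \<times> left_steps (Suc k) (n - i))"
    then obtain P Q k where x: "x = (P, Q)" "k < n" "count_list P West = j" "length P + 1 = n - k"
      "count_list Q West = k" "length Q + 1 = n - i" by (auto simp: left_steps_def)
    then show "x \<in> ?X" using count_West_South[of P] by (auto simp: h_def l_def)
  qed
  have "(M3 n * M1 n) $$ (i, j) = (\<Sum>k<n. M3 n $$ (i, k) * (M1 n $$ (k, j) :: 'k qtorus))"
    using ij by (simp add: dims scalar_prod_def atLeast0LessThan)
  also have "\<dots> = (\<Sum>k<n. \<Sum>(P, Q)\<in>left_steps (Suc j) (n - k) \<times> left_steps (Suc k) (n - i).
      scalar ?u * pair_term n h P Q)"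
  proof (rule sum.cong[OF refl])
    fix k assume "k \<in> {..<n}"
    then have k: "k < n" by simp
    have "M3 n $$ (i, k) * (M1 n $$ (k, j) :: 'k qtorus) =
        (\<Sum>P\<in>left_steps (Suc j) (n - k). \<Sum>Q\<in>left_steps (Suc k) (n - i).
          monom ?u (face_sum (rotated_region n Q) - D2_exponent n)
          * monom (qs_coeff (Suc k)) (face_sum (region n h P False) - D1_exponent n))"
      unfolding M1_entry[OF k ij(2)] M3_entry[OF ij(1) k] sum_product h_def by (rule sum.swap)
    also have "\<dots> = (\<Sum>P\<in>left_steps (Suc j) (n - k). \<Sum>Q\<in>left_steps (Suc k) (n - i). scalar ?u * pair_term n h P Q)"
      using k ij by (intro sum.cong refl entry_product) (auto simp: left_steps_def h_def)
    finally show "M3 n $$ (i, k) * (M1 n $$ (k, j) :: 'k qtorus) =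
        (\<Sum>(P, Q)\<in>left_steps (Suc j) (n - k) \<times> left_steps (Suc k) (n - i). scalar ?u * pair_term n h P Q)"
      by (simp add: sum.cartesian_product)
  qed
  also have "\<dots> = (\<Sum>(P, Q)\<in>?X. scalar ?u * pair_term n h P Q)"
    unfolding X
  proof (rule sum.UNION_disjoint[symmetric])
    show "\<forall>k\<in>{..<n}. \<forall>k'\<in>{..<n}. k \<noteq> k' \<longrightarrow>
      (left_steps (Suc j) (n - k) \<times> left_steps (Suc k) (n - i))
        \<inter> (left_steps (Suc j) (n - k') \<times> left_steps (Suc k') (n - i)) = {}"
      by (auto simp: left_steps_def)
  qed simp_all
  also have "\<dots> = (\<Sum>p | count_list p West + l = j \<and> count_list p South = h.
      scalar ?u * pair_term n h (p @ replicate l West) (replicate l South))"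
  proof (rule sum_pairs_cancel)
    show "l \<le> j + h" using ij by (simp add: l_def h_def)
    fix t p q
    assume pq: "count_list p West + t = j" "count_list p South + count_list q West + 1 = h"
    then have "length p + t + count_list q West + 2 = n"
      using count_West_South[of p] ij by (simp add: h_def)
    from pair_term_cancel[OF pq(2) this, where 'k = 'k]
    show "scalar ?u * pair_term n h (p @ replicate t West) (replicate t South @ West # q)
      + scalar ?u * pair_term n h (p @ South # replicate t West) (replicate t South @ South # q) = 0"
      unfolding distrib_left[symmetric] by simp
  qed
  also have "{p. count_list p West + l = j \<and> count_list p South = h} = bottom_steps n (Suc j) (n - i)"
    using ij by (auto simp: bottom_steps_def l_def h_def)
  also have "(\<Sum>p\<in>bottom_steps n (Suc j) (n - i). scalar ?u * pair_term n h (p @ replicate l West) (replicate l South))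
      = M2 n $$ (i, j)"
    unfolding M2_entry[OF ij]
  proof (rule sum.cong[OF refl])
    fix p assume p: "p \<in> bottom_steps n (Suc j) (n - i)"
    then have "count_list p South = h" "length p + l + 1 = n"
      using count_West_South[of p] ij by (auto simp: bottom_steps_def h_def l_def)
    from pair_term_backtrack[OF this, where 'k = 'k]
    show "scalar ?u * pair_term n h (p @ replicate l West) (replicate l South) =
      monom (?u * qpow (- (1 / (2 * of_nat n)))) (face_sum (region n (n - Suc j) p True) - D1_exponent n - D2_exponent n)"
      by (simp add: scalar_mult h_def)
  qed
  finally show "(M3 n * M1 n) $$ (i, j) = (M2 n $$ (i, j) :: 'k qtorus)" .
qed

text \<open>
  \<open>Smat\<close> reverses the order of the rows, so triangularity is that of \<open>M $$ (n - 1 - i, j)\<close>, and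
  the columns of the inverse have to be reversed instead.
\<close>

lemma reversed_triangular_invertible:
  fixes M :: "'k::qfield qtorus mat"
  assumes M: "M \<in> carrier_mat n n"
    and inj: "inj_on m {..<n}"
    and entries: "\<And>i j. i < n \<Longrightarrow> j < n \<Longrightarrow> M $$ (i, j) \<in> quantum_torus n"
    and tri: "\<And>i j. i < n \<Longrightarrow> j < n \<Longrightarrow> m i < (m j :: nat) \<Longrightarrow> M $$ (n - 1 - i, j) = 0"
    and diag: "\<And>i. i < n \<Longrightarrow> \<exists>u \<kappa>. u \<noteq> 0 \<and> Poly_Mapping.keys \<kappa> \<subseteq> lattice n \<and> M $$ (n - 1 - i, i) = monom u \<kappa>"
  shows "\<exists>B. is_inverse_mat n M B"
proof -
  note closed = quantum_torus_1 quantum_torus_0 quantum_torus_diff quantum_torus_mult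
  have unit: "\<exists>u\<in>quantum_torus n. M $$ (n - 1 - i, i) * u = 1 \<and> u * M $$ (n - 1 - i, i) = 1" if "i < n" for i
  proof -
    from diag[OF that] obtain u \<kappa> where "u \<noteq> 0" "Poly_Mapping.keys \<kappa> \<subseteq> lattice n" "M $$ (n - 1 - i, i) = monom u \<kappa>"
      by blast
    then show ?thesis
      using monom_inverse[of u \<kappa>] monom_in_quantum_torus[of "- \<kappa>" n "1 / u"] by (auto simp: keys_def)
  qed
  obtain X where X: "\<And>i j. i < n \<Longrightarrow> j < n \<Longrightarrow> X i j \<in> quantum_torus n"
    "\<And>i j. i < n \<Longrightarrow> j < n \<Longrightarrow> m i < m j \<Longrightarrow> X i j = 0"
    "\<And>i. i < n \<Longrightarrow> \<exists>u\<in>quantum_torus n. X i i * u = 1 \<and> u * X i i = 1"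
    "\<And>i j. i < n \<Longrightarrow> j < n \<Longrightarrow> (\<Sum>k<n. M $$ (n - 1 - i, k) * X k j) = (if i = j then 1 else 0)"
    by (rule triangular_right_inverse[of m n "\<lambda>i j. M $$ (n - 1 - i, j)" "quantum_torus n"])
      (use inj tri closed entries unit in auto)
  obtain Y where Y: "\<And>i j. i < n \<Longrightarrow> j < n \<Longrightarrow> (\<Sum>k<n. X i k * Y k j) = (if i = j then 1 else 0)"
    by (rule triangular_right_inverse[of m n X "quantum_torus n"]) (use inj X closed in auto)
  define L where "L = mat n n (\<lambda>(i, j). M $$ (n - 1 - i, j))"
  define X' where "X' = mat n n (\<lambda>(i, j). X i j)"
  define Y' where "Y' = mat n n (\<lambda>(i, j). Y i j)"
  have carrier: "L \<in> carrier_mat n n" "X' \<in> carrier_mat n n" "Y' \<in> carrier_mat n n"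
    by (simp_all add: L_def X'_def Y'_def)
  have LX: "L * X' = 1\<^sub>m n"
    using X(4) by (intro eq_matI) (auto simp: L_def X'_def scalar_prod_def atLeast0LessThan)
  have XY: "X' * Y' = 1\<^sub>m n"
    by (rule eq_matI) (auto simp: Y'_def X'_def scalar_prod_def atLeast0LessThan Y)
  have "Y' = (L * X') * Y'" using LX carrier by simp
  also have "\<dots> = L" using assoc_mult_mat[OF carrier] XY carrier by simp
  finally have XL: "X' * L = 1\<^sub>m n" using XY by simp
  define B where "B = mat n n (\<lambda>(i, j). X i (n - 1 - j))"
  have B: "B \<in> carrier_mat n n" by (simp add: B_def)
  have "M * B = 1\<^sub>m n"
  proof (rule eq_matI)
    fix i j assume "i < dim_row (1\<^sub>m n :: 'k qtorus mat)" "j < dim_col (1\<^sub>m n :: 'k qtorus mat)"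
    then have ij: "i < n" "j < n" by auto
    then have "(M * B) $$ (i, j) = (\<Sum>k<n. M $$ (n - 1 - (n - 1 - i), k) * X k (n - 1 - j))"
      using M by (simp add: B_def scalar_prod_def atLeast0LessThan)
    also have "\<dots> = (if n - 1 - i = n - 1 - j then 1 else 0)" using ij by (intro X(4)) auto
    finally show "(M * B) $$ (i, j) = 1\<^sub>m n $$ (i, j)" using ij by auto
  qed (use M B in auto)
  moreover have "B * M = 1\<^sub>m n"
  proof (rule eq_matI)
    fix i j assume "i < dim_row (1\<^sub>m n :: 'k qtorus mat)" "j < dim_col (1\<^sub>m n :: 'k qtorus mat)"
    then have ij: "i < n" "j < n" by auto
    have "(B * M) $$ (i, j) = (\<Sum>k<n. X i (n - 1 - k) * M $$ (k, j))"
      using M ij by (simp add: B_def scalar_prod_def atLeast0LessThan)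
    also have "\<dots> = (\<Sum>k<n. X i k * M $$ (n - 1 - k, j))"
      by (rule sum.reindex_bij_witness[of _ "\<lambda>k. n - 1 - k" "\<lambda>k. n - 1 - k"]) auto
    also have "\<dots> = (X' * L) $$ (i, j)"
      using ij by (simp add: X'_def L_def scalar_prod_def atLeast0LessThan)
    finally show "(B * M) $$ (i, j) = 1\<^sub>m n $$ (i, j)" unfolding XL .
  qed (use M B in auto)
  moreover have "elements_mat B \<subseteq> quantum_torus n"
    using X(1) by (auto simp: elements_mat_def B_def)
  ultimately show ?thesis
    using M B unfolding is_inverse_mat_def inverts_mat_def by auto
qed

lemma keys_exponents:
  "Poly_Mapping.keys (D1_exponent n) \<subseteq> lattice n" "Poly_Mapping.keys (D2_exponent n) \<subseteq> lattice n"
  "A \<subseteq> lattice n \<Longrightarrow> Poly_Mapping.keys (face_sum A) \<subseteq> lattice n"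
proof -
  show "Poly_Mapping.keys (D1_exponent n) \<subseteq> lattice n" "Poly_Mapping.keys (D2_exponent n) \<subseteq> lattice n"
    by (auto simp: in_keys_iff D1_exponent_def D2_exponent_def lookup_lattice_sum split: if_splits)
  assume A: "A \<subseteq> lattice n"
  then have "finite A" using finite_lattice finite_subset by blast
  then show "Poly_Mapping.keys (face_sum A) \<subseteq> lattice n"
    using A by (auto simp: in_keys_iff lookup_face_sum split: if_splits)
qed

lemma keys_diff_lattice:
  "Poly_Mapping.keys \<kappa> \<subseteq> lattice n \<Longrightarrow> Poly_Mapping.keys \<mu> \<subseteq> lattice n \<Longrightarrow> Poly_Mapping.keys (\<kappa> - \<mu> :: exponent) \<subseteq> lattice n"
  using keys_diff[of \<kappa> \<mu>] by blast

lemma qs_coeff_nonzero: "qs_coeff i \<noteq> (0 :: 'k::qfield)"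
  by (simp add: qs_coeff_def qpow_nonzero)

text \<open>
  Above the diagonal there is no path: \<open>Source (Suc j)\<close> is \<open>j\<close> west steps away from the left
  side, and a path to \<open>LeftSink (Suc i)\<close> has only \<open>i\<close> steps. On the diagonal the path goes west
  all the way, and in \<open>M2_invertible\<close> south all the way.
\<close>

lemma M1_invertible: "\<exists>B. is_inverse_mat n (M1 n :: 'k::qfield qtorus mat) B"
proof (rule reversed_triangular_invertible[of _ n "\<lambda>i. i"])
  have keys: "Poly_Mapping.keys (face_sum (region n h ws False) - D1_exponent n) \<subseteq> lattice n" for h ws
    by (intro keys_diff_lattice keys_exponents region_subset)
  show "M1 n $$ (i, j) \<in> (quantum_torus n :: 'k qtorus set)" if "i < n" "j < n" for i j
    unfolding M1_entry[OF that] by (intro quantum_torus_sum monom_in_quantum_torus keys)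
  show "M1 n $$ (n - 1 - i, j) = (0 :: 'k qtorus)" if "i < n" "j < n" "i < j" for i j
  proof -
    have "ws \<notin> left_steps (Suc j) (Suc i)" for ws
      using that count_le_length[of ws West] by (auto simp: left_steps_def)
    then have "left_steps (Suc j) (n - (n - 1 - i)) = {}" using that by auto
    then show ?thesis using M1_entry[of "n - 1 - i" n j, where 'k = 'k] that by simp
  qed
  show "\<exists>u \<kappa>. u \<noteq> 0 \<and> Poly_Mapping.keys \<kappa> \<subseteq> lattice n \<and> M1 n $$ (n - 1 - i, i) = (monom u \<kappa> :: 'k qtorus)"
    if "i < n" for i
  proof -
    have "ws = replicate i West" if "ws \<in> left_steps (Suc i) (Suc i)" for ws
    proof -
      have "count_list ws South = 0" "length ws = i"
        using that count_West_South[of ws] by (auto simp: left_steps_def)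
      then show ?thesis
        by (intro replicate_eqI) (auto simp: count_list_0_iff, metis step.exhaust)
    qed
    then have "left_steps (Suc i) (Suc i) = {replicate i West}"
      by (auto simp: left_steps_def count_replicate)
    then have "left_steps (Suc i) (n - (n - 1 - i)) = {replicate i West}" using that by simp
    then show ?thesis
      using M1_entry[of "n - 1 - i" n i, where 'k = 'k] that keys qs_coeff_nonzero
      by (intro exI[of _ "qs_coeff (Suc (n - 1 - i)) :: 'k"]
        exI[of _ "face_sum (region n (n - Suc i) (replicate i West) False) - D1_exponent n"]) simp
  qed
qed (simp_all add: M_carrier)

lemma M2_invertible: "\<exists>B. is_inverse_mat n (M2 n :: 'k::qfield qtorus mat) B"
proof (rule reversed_triangular_invertible[of _ n "\<lambda>i. n - i"])
  have keys: "Poly_Mapping.keys (face_sum (region n h ws True) - D1_exponent n - D2_exponent n) \<subseteq> lattice n" for h ws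
    by (intro keys_diff_lattice keys_exponents region_subset)
  show "inj_on (\<lambda>i. n - i) {..<n}" by (auto intro: inj_onI)
  show "M2 n $$ (i, j) \<in> (quantum_torus n :: 'k qtorus set)" if "i < n" "j < n" for i j
    unfolding M2_entry[OF that] by (intro quantum_torus_sum monom_in_quantum_torus keys)
  show "M2 n $$ (n - 1 - i, j) = (0 :: 'k qtorus)" if "i < n" "j < n" "n - i < n - j" for i j
  proof -
    have "bottom_steps n (Suc j) (n - (n - 1 - i)) = {}" using that by (auto simp: bottom_steps_def)
    then show ?thesis using M2_entry[of "n - 1 - i" n j, where 'k = 'k] that by simp
  qed
  show "\<exists>u \<kappa>. u \<noteq> 0 \<and> Poly_Mapping.keys \<kappa> \<subseteq> lattice n \<and> M2 n $$ (n - 1 - i, i) = (monom u \<kappa> :: 'k qtorus)"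
    if "i < n" for i
  proof -
    have "ws = replicate (n - Suc i) South" if "ws \<in> bottom_steps n (Suc i) (Suc i)" for ws
    proof -
      have "count_list ws West = 0" "length ws = n - Suc i"
        using that count_West_South[of ws] by (auto simp: bottom_steps_def)
      then show ?thesis
        by (intro replicate_eqI) (auto simp: count_list_0_iff, metis step.exhaust)
    qed
    then have "bottom_steps n (Suc i) (Suc i) = {replicate (n - Suc i) South}"
      using that by (auto simp: bottom_steps_def count_replicate)
    then have "bottom_steps n (Suc i) (n - (n - 1 - i)) = {replicate (n - Suc i) South}" using that by simp
    then show ?thesis
      using M2_entry[of "n - 1 - i" n i, where 'k = 'k] that keys
      by (intro exI[of _ "qs_coeff (Suc (n - 1 - i)) * qpow (- (1 / (2 * of_nat n))) :: 'k"]
        exI[of _ "face_sum (region n (n - Suc i) (replicate (n - Suc i) South) True) - D1_exponent n - D2_exponent n"])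
        (simp add: qs_coeff_nonzero qpow_nonzero)
  qed
qed (simp_all add: M_carrier)

text \<open>
  From \<open>M3 n * M1 n = M2 n\<close> the inverse \<open>B\<close> of \<open>M2 n\<close> gives a left inverse \<open>B * M3 n\<close> of \<open>M1 n\<close>.
  As \<open>M1 n\<close> is invertible, it is also a right inverse.
\<close>

theorem theorem2p6:
  fixes n :: nat
  assumes "n \<ge> 2"
  shows "(\<exists>B. is_inverse_mat n (M2 n :: 'k::qfield qtorus mat) B) \<and>
         (T1 n * T2 n * T3 n :: 'k qtorus mat) = 1\<^sub>m n"
proof
  show ex: "\<exists>B. is_inverse_mat n (M2 n :: 'k qtorus mat) B" by (rule M2_invertible)
  obtain B where B: "is_inverse_mat n (M2 n :: 'k qtorus mat) B" using ex ..
  obtain C where C: "is_inverse_mat n (M1 n :: 'k qtorus mat) C" using M1_invertible by blast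
  note M = M_carrier[of n, where 'k = 'k]
  have Bc: "B \<in> carrier_mat n n" "M2 n * B = 1\<^sub>m n" "B * M2 n = 1\<^sub>m n"
    using B M by (auto simp: is_inverse_mat_def inverts_mat_def)
  have Cc: "C \<in> carrier_mat n n" "M1 n * C = 1\<^sub>m n"
    using C M by (auto simp: is_inverse_mat_def inverts_mat_def)
  have "T2 n = B"
    unfolding T2_def
  proof (rule the_equality)
    show "is_inverse_mat n (M2 n) B" by (rule B)
    fix B' :: "'k qtorus mat" assume "is_inverse_mat n (M2 n) B'"
    then have B': "B' \<in> carrier_mat n n" "B' * M2 n = 1\<^sub>m n"
      using M by (auto simp: is_inverse_mat_def inverts_mat_def)
    have "B' = B' * (M2 n * B)" using B' Bc by simp
    also have "\<dots> = B" using assoc_mult_mat[OF B'(1) M(2) Bc(1)] B' Bc by simp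
    finally show "B' = B" .
  qed
  moreover have "B * M3 n = C"
  proof -
    have "B * M3 n = (B * M3 n) * (M1 n * C)" using Bc M Cc by simp
    also have "\<dots> = B * (M3 n * M1 n) * C"
      using Bc(1) Cc(1) M by (simp add: assoc_mult_mat[of _ n n _ n _ n])
    also have "\<dots> = C" using Bc Cc by (simp add: M3_times_M1)
    finally show ?thesis .
  qed
  ultimately show "T1 n * T2 n * T3 n = (1\<^sub>m n :: 'k qtorus mat)"
    unfolding T1_def T3_def using assoc_mult_mat[OF M(1) Bc(1) M(3)] Cc by simp
qed

end
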